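(* If $\mathbb{Z}(\mathcal{M}_I(\mathcal{R}))=\mathbf{0}$ and \[ \mathcal{M}_I(\mathcal{R})_{\mathbf{0}}=\sum_{g\in\Sigma}\left(\mathcal{M}_I(\mathcal{R})_g\star\mathcal{M}_I(\mathcal{R})_{-\beta^{-1}\circ\alpha(g)}\right), \] then $(\mathcal{M}_I(\mathcal{R}),\star,\psi,\phi)$ is the direct sum of the graded ideals $\mathfrak{I}_{[g]}$, that is, \[ \mathcal{M}_I(\mathcal{R})=\bigoplus_{[g]\in\Sigma/\sim}\mathfrak{I}_{[g]}. \]
   Context: $\mathbb{N}$ is the set of non-negative integers. For subsets $X,Y$ of an algebra with product $\star$, $X\star Y$ denotes the submodule spanned by all $x\star y$, $x\in X$, $y\in Y$. Setting. Let $\mathcal{R}$ be a commutative ring, $I$ an arbitrary index set, and $\mathcal{M}_I(\mathcal{R})$ the $\mathcal{R}$-algebra of $I\times I$ matrices over $\mathcal{R}$ with only finitely many non-zero entries, with the usual product (juxtaposition). Let $\psi,\phi$ be two commuting $\mathcal{R}$-algebra automorphisms of it and put $x\star y:=\psi(x)\phi(y)$. Let $(G,+)$ be an abelian group with neutral element $\mathbf{0}$ and let $\alpha,\beta$ be two commuting automorphisms of $G$. Suppose $\mathcal{M}_I(\mathcal{R})=\bigoplus_{g\in G}\mathcal{M}_I(\mathcal{R})_g$ is a direct sum of $\mathcal{R}$-submodules such that, for all $g,g'\in G$, $\psi(\mathcal{M}_I(\mathcal{R})_g)\subseteq\mathcal{M}_I(\mathcal{R})_{\alpha(g)}$, $\phi(\mathcal{M}_I(\mathcal{R})_g)\subseteq\mathcal{M}_I(\mathcal{R})_{\beta(g)}$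 and $\mathcal{M}_I(\mathcal{R})_g\star\mathcal{M}_I(\mathcal{R})_{g'}\subseteq\mathcal{M}_I(\mathcal{R})_{\alpha(g)+\beta(g')}$. The support is $\Sigma:=\{g\in G\setminus\{\mathbf{0}\}\mid \mathcal{M}_I(\mathcal{R})_g\neq 0\}$. It is assumed symmetric: $g\in\Sigma$ implies $-g\in\Sigma$. Connections. For $g,g'\in\Sigma$, a connection from $g$ to $g'$ is a finite sequence $g_1,\dots,g_k$ of elements of $\Sigma$ ($k\ge 1$) such that: if $k=1$, then $g_1\in\{\alpha^i\circ\beta^j(g)\mid i,j\in\mathbb{N}\}\cap\{\pm\alpha^m\circ\beta^n(g')\mid m,n\in\mathbb{N}\}$; if $k\ge 2$, then (1) $g_1\in\{\alpha^i\circ\beta^j(g)\mid i,j\in\mathbb{N}\}$, (2) for every $2\le l\le k-1$ the element $\alpha^{l-1}(g_1)+\sum_{t=2}^{l}\alpha^{l-t}\circ\beta(g_t)$ belongs to $\Sigma$, and (3) $\alpha^{k-1}(g_1)+\sum_{t=2}^{k}\alpha^{k-t}\circ\beta(g_t)\in\{\pm\alpha^m\circ\beta^n(g')\mid m,n\in\mathbb{N}\}$. Write $g\sim g'$ if a connection from $g$ to $g'$ exists; $\sim$ is an equivalence relation on $\Sigma$, $[g]$ denotes the class of $g$, and $\Sigma/\sim$ is the set of classes. For $g\in\Sigma$ put $\mathfrak{I}_{\mathbf{0},[g]}:=\operatorname{Span}_{\mathcal{R}}\{\mathcal{M}_I(\mathcal{R})_{\beta(g')}\star\mathcal{M}_I(\mathcal{R})_{-\alpha(g')}\mid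 g'\in[g]\}\subseteq\mathcal{M}_I(\mathcal{R})_{\mathbf{0}}$, $V_{[g]}:=\bigoplus_{g'\in[g]}\mathcal{M}_I(\mathcal{R})_{g'}$ and $\mathfrak{I}_{[g]}:=\mathfrak{I}_{\mathbf{0},[g]}\oplus V_{[g]}$. A graded ideal of $(\mathcal{M}_I(\mathcal{R}),\star,\psi,\phi)$ is an $\mathcal{R}$-submodule $\mathfrak{I}$ with $\mathfrak{I}\star\mathcal{M}_I(\mathcal{R})+\mathcal{M}_I(\mathcal{R})\star\mathfrak{I}\subseteq\mathfrak{I}$, $\psi(\mathfrak{I})=\mathfrak{I}$, $\phi(\mathfrak{I})=\mathfrak{I}$, and $\mathfrak{I}=\bigoplus_{g\in G}(\mathfrak{I}\cap\mathcal{M}_I(\mathcal{R})_g)$. The centre is $\mathbb{Z}(\mathcal{M}_I(\mathcal{R})):=\{v\in\mathcal{M}_I(\mathcal{R})\mid v\star\mathcal{M}_I(\mathcal{R})+\mathcal{M}_I(\mathcal{R})\star v=\mathbf{0}\}$ (a two-sided annihilator). *)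

theory Defs
  imports Complex_Main "HOL-Library.Poly_Mapping" "HOL-Library.Set_Algebras"
begin

text \<open>
  A matrix with finitely many non-zero entries is a finitely supported map on pairs of indices.
  The index set is an explicit set \<open>I\<close>, so that it may be empty. The coefficients lie in the class
  \<open>comm_ring\<close>, which requires no unit: this admits the zero ring, which \<open>comm_ring_1\<close>
  (and with it the library's \<open>module\<close> locale) excludes.
\<close>

type_synonym ('i, 'r) fmat = "('i \<times> 'i) \<Rightarrow>\<^sub>0 'r"

definition Mat :: "'i set \<Rightarrow> ('i, 'r::comm_ring) fmat set" where
  "Mat I = {A. Poly_Mapping.keys A \<subseteq> I \<times> I}"

definition mat_mult :: "('i, 'r::comm_ring) fmat \<Rightarrow> ('i, 'r) fmat \<Rightarrow> ('i, 'r) fmat" where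
  "mat_mult A B =
     Abs_poly_mapping (\<lambda>(i, k). Sum_any (\<lambda>j. Poly_Mapping.lookup A (i, j) * Poly_Mapping.lookup B (j, k)))"

lemma lookup_mat_mult:
  fixes A B :: "('i, 'r::comm_ring) fmat"
  shows "Poly_Mapping.lookup (mat_mult A B) (i, k) =
     Sum_any (\<lambda>j. Poly_Mapping.lookup A (i, j) * Poly_Mapping.lookup B (j, k))"
    and "finite {j. Poly_Mapping.lookup A (i, j) * Poly_Mapping.lookup B (j, k) \<noteq> 0}"
proof -
  let ?f = "\<lambda>(i, k). Sum_any (\<lambda>j. Poly_Mapping.lookup A (i, j) * Poly_Mapping.lookup B (j, k))"
  have "{p. ?f p \<noteq> 0} \<subseteq> (fst ` Poly_Mapping.keys A) \<times> (snd ` Poly_Mapping.keys B)"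
  proof
    fix p assume "p \<in> {p. ?f p \<noteq> 0}"
    then obtain i k where p: "p = (i, k)" and
      nz: "Sum_any (\<lambda>j. Poly_Mapping.lookup A (i, j) * Poly_Mapping.lookup B (j, k)) \<noteq> 0"
      by (cases p) auto
    from nz obtain j where "Poly_Mapping.lookup A (i, j) * Poly_Mapping.lookup B (j, k) \<noteq> 0"
      by (rule Sum_any.not_neutral_obtains_not_neutral)
    then have "(i, j) \<in> Poly_Mapping.keys A" "(j, k) \<in> Poly_Mapping.keys B"
      by (auto simp: in_keys_iff)
    then show "p \<in> (fst ` Poly_Mapping.keys A) \<times> (snd ` Poly_Mapping.keys B)"
      unfolding p by (metis SigmaI fst_conv image_eqI snd_conv)
  qed
  then have "finite {p. ?f p \<noteq> 0}"
    by (rule finite_subset) simp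
  then show "Poly_Mapping.lookup (mat_mult A B) (i, k) =
     Sum_any (\<lambda>j. Poly_Mapping.lookup A (i, j) * Poly_Mapping.lookup B (j, k))"
    by (simp add: mat_mult_def Abs_poly_mapping_inverse)
  have "{j. Poly_Mapping.lookup A (i, j) * Poly_Mapping.lookup B (j, k) \<noteq> 0}
      \<subseteq> snd ` Poly_Mapping.keys A"
  proof
    fix j assume "j \<in> {j. Poly_Mapping.lookup A (i, j) * Poly_Mapping.lookup B (j, k) \<noteq> 0}"
    then have "(i, j) \<in> Poly_Mapping.keys A"
      by (auto simp: in_keys_iff)
    then show "j \<in> snd ` Poly_Mapping.keys A"
      by (metis image_eqI snd_conv)
  qed
  then show "finite {j. Poly_Mapping.lookup A (i, j) * Poly_Mapping.lookup B (j, k) \<noteq> 0}"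
    by (rule finite_subset) simp
qed

definition mat_scale :: "'r::comm_ring \<Rightarrow> ('i, 'r) fmat \<Rightarrow> ('i, 'r) fmat" where
  "mat_scale r A = Poly_Mapping.map ((*) r) A"

text \<open>
  Closure under negation is listed because it does not follow from the other conditions
  when \<open>'r\<close> has no unit.
\<close>

definition is_submodule :: "('i, 'r::comm_ring) fmat set \<Rightarrow> bool" where
  "is_submodule S \<longleftrightarrow>
     0 \<in> S \<and> (\<forall>A\<in>S. \<forall>B\<in>S. A + B \<in> S) \<and> (\<forall>A\<in>S. - A \<in> S) \<and> (\<forall>r. \<forall>A\<in>S. mat_scale r A \<in> S)"

definition mat_span :: "('i, 'r::comm_ring) fmat set \<Rightarrow> ('i, 'r) fmat set" where
  "mat_span X = is_submodule hull X"

definition sum_submodules ::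
    "'j set \<Rightarrow> ('j \<Rightarrow> ('i, 'r::comm_ring) fmat set) \<Rightarrow> ('i, 'r) fmat set" where
  "sum_submodules J F = mat_span (\<Union>j\<in>J. F j)"

definition is_direct_sum ::
    "('i, 'r::comm_ring) fmat set \<Rightarrow> 'j set \<Rightarrow> ('j \<Rightarrow> ('i, 'r) fmat set) \<Rightarrow> bool" where
  "is_direct_sum T J F \<longleftrightarrow>
     (\<forall>j\<in>J. is_submodule (F j)) \<and>
     T = sum_submodules J F \<and>
     (\<forall>K x. finite K \<and> K \<subseteq> J \<and> (\<forall>j\<in>K. x j \<in> F j) \<and> (\<Sum>j\<in>K. x j) = 0 \<longrightarrow> (\<forall>j\<in>K. x j = 0))"

text \<open>No condition on units: \<^term>\<open>Mat I\<close> has none in general.\<close>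

definition mat_automorphism ::
    "'i set \<Rightarrow> (('i, 'r::comm_ring) fmat \<Rightarrow> ('i, 'r) fmat) \<Rightarrow> bool" where
  "mat_automorphism I f \<longleftrightarrow>
     bij_betw f (Mat I) (Mat I) \<and>
     (\<forall>A\<in>Mat I. \<forall>B\<in>Mat I. f (A + B) = f A + f B) \<and>
     (\<forall>r. \<forall>A\<in>Mat I. f (mat_scale r A) = mat_scale r (f A)) \<and>
     (\<forall>A\<in>Mat I. \<forall>B\<in>Mat I. f (mat_mult A B) = mat_mult (f A) (f B))"

definition group_automorphism :: "('g::ab_group_add \<Rightarrow> 'g) \<Rightarrow> bool" where
  "group_automorphism f \<longleftrightarrow> additive f \<and> bij f"

definition star ::
    "(('i, 'r::comm_ring) fmat \<Rightarrow> ('i, 'r) fmat) \<Rightarrow> (('i, 'r) fmat \<Rightarrow> ('i, 'r) fmat) \<Rightarrow>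
     ('i, 'r) fmat \<Rightarrow> ('i, 'r) fmat \<Rightarrow> ('i, 'r) fmat" where
  "star \<psi> \<phi> x y = mat_mult (\<psi> x) (\<phi> y)"

definition star_set ::
    "(('i, 'r::comm_ring) fmat \<Rightarrow> ('i, 'r) fmat) \<Rightarrow> (('i, 'r) fmat \<Rightarrow> ('i, 'r) fmat) \<Rightarrow>
     ('i, 'r) fmat set \<Rightarrow> ('i, 'r) fmat set \<Rightarrow> ('i, 'r) fmat set" where
  "star_set \<psi> \<phi> X Y = mat_span {star \<psi> \<phi> x y | x y. x \<in> X \<and> y \<in> Y}"

definition support :: "('g::ab_group_add \<Rightarrow> ('i, 'r::comm_ring) fmat set) \<Rightarrow> 'g set" where
  "support M = {g. g \<noteq> 0 \<and> M g \<noteq> {0}}"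

text \<open>Below, \<open>+\<close> between sets of matrices is the elementwise sum.\<close>

definition centre ::
    "'i set \<Rightarrow> (('i, 'r::comm_ring) fmat \<Rightarrow> ('i, 'r) fmat) \<Rightarrow>
     (('i, 'r) fmat \<Rightarrow> ('i, 'r) fmat) \<Rightarrow> ('i, 'r) fmat set" where
  "centre I \<psi> \<phi> =
     {v \<in> Mat I. star_set \<psi> \<phi> {v} (Mat I) + star_set \<psi> \<phi> (Mat I) {v} = {0}}"

definition graded_ideal ::
    "'i set \<Rightarrow> (('i, 'r::comm_ring) fmat \<Rightarrow> ('i, 'r) fmat) \<Rightarrow>
     (('i, 'r) fmat \<Rightarrow> ('i, 'r) fmat) \<Rightarrow> ('g::ab_group_add \<Rightarrow> ('i, 'r) fmat set) \<Rightarrow>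
     ('i, 'r) fmat set \<Rightarrow> bool" where
  "graded_ideal I \<psi> \<phi> M J \<longleftrightarrow>
     J \<subseteq> Mat I \<and> is_submodule J \<and>
     star_set \<psi> \<phi> J (Mat I) + star_set \<psi> \<phi> (Mat I) J \<subseteq> J \<and>
     \<psi> ` J = J \<and> \<phi> ` J = J \<and>
     is_direct_sum J UNIV (\<lambda>g. J \<inter> M g)"

definition orbit :: "('g \<Rightarrow> 'g) \<Rightarrow> ('g \<Rightarrow> 'g) \<Rightarrow> 'g \<Rightarrow> 'g set" where
  "orbit \<alpha> \<beta> g = {(\<alpha> ^^ i) ((\<beta> ^^ j) g) | i j. True}"

definition pm_orbit :: "('g::ab_group_add \<Rightarrow> 'g) \<Rightarrow> ('g \<Rightarrow> 'g) \<Rightarrow> 'g \<Rightarrow> 'g set" where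
  "pm_orbit \<alpha> \<beta> g = orbit \<alpha> \<beta> g \<union> uminus ` orbit \<alpha> \<beta> g"

definition conn_sum :: "('g::ab_group_add \<Rightarrow> 'g) \<Rightarrow> ('g \<Rightarrow> 'g) \<Rightarrow> (nat \<Rightarrow> 'g) \<Rightarrow> nat \<Rightarrow> 'g" where
  "conn_sum \<alpha> \<beta> s l = (\<alpha> ^^ (l - 1)) (s 1) + (\<Sum>t=2..l. (\<alpha> ^^ (l - t)) (\<beta> (s t)))"

text \<open>The sequence is \<open>s 1, \<dots>, s k\<close>; other values of \<open>s\<close> are irrelevant.\<close>

definition connection ::
    "('g::ab_group_add \<Rightarrow> 'g) \<Rightarrow> ('g \<Rightarrow> 'g) \<Rightarrow> 'g set \<Rightarrow> 'g \<Rightarrow> 'g \<Rightarrow> nat \<Rightarrow> (nat \<Rightarrow> 'g) \<Rightarrow> bool" where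
  "connection \<alpha> \<beta> S g g' k s \<longleftrightarrow>
     k \<ge> 1 \<and> (\<forall>l\<in>{1..k}. s l \<in> S) \<and>
     (if k = 1 then s 1 \<in> orbit \<alpha> \<beta> g \<inter> pm_orbit \<alpha> \<beta> g'
      else s 1 \<in> orbit \<alpha> \<beta> g \<and>
           (\<forall>l\<in>{2..k-1}. conn_sum \<alpha> \<beta> s l \<in> S) \<and>
           conn_sum \<alpha> \<beta> s k \<in> pm_orbit \<alpha> \<beta> g')"

definition conn_rel ::
    "('g::ab_group_add \<Rightarrow> 'g) \<Rightarrow> ('g \<Rightarrow> 'g) \<Rightarrow> 'g set \<Rightarrow> ('g \<times> 'g) set" where
  "conn_rel \<alpha> \<beta> S = {(g, g'). g \<in> S \<and> g' \<in> S \<and> (\<exists>k s. connection \<alpha> \<beta> S g g' k s)}"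

text \<open>
  The ideal attached to a class \<open>C\<close> of connected elements. Both sums written as direct sums in
  the definition of the ideal are automatically direct, as \<open>M\<close> is a grading and the first summand
  of \<open>class_ideal\<close> lies in degree 0, so the plain sums are used.
\<close>

definition class_zero_part ::
    "(('i, 'r::comm_ring) fmat \<Rightarrow> ('i, 'r) fmat) \<Rightarrow> (('i, 'r) fmat \<Rightarrow> ('i, 'r) fmat) \<Rightarrow>
     ('g::ab_group_add \<Rightarrow> 'g) \<Rightarrow> ('g \<Rightarrow> 'g) \<Rightarrow> ('g \<Rightarrow> ('i, 'r) fmat set) \<Rightarrow>
     'g set \<Rightarrow> ('i, 'r) fmat set" where
  "class_zero_part \<psi> \<phi> \<alpha> \<beta> M C = mat_span (\<Union>g\<in>C. star_set \<psi> \<phi> (M (\<beta> g)) (M (- \<alpha> g)))"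

definition class_ideal ::
    "(('i, 'r::comm_ring) fmat \<Rightarrow> ('i, 'r) fmat) \<Rightarrow> (('i, 'r) fmat \<Rightarrow> ('i, 'r) fmat) \<Rightarrow>
     ('g::ab_group_add \<Rightarrow> 'g) \<Rightarrow> ('g \<Rightarrow> 'g) \<Rightarrow> ('g \<Rightarrow> ('i, 'r) fmat set) \<Rightarrow>
     'g set \<Rightarrow> ('i, 'r) fmat set" where
  "class_ideal \<psi> \<phi> \<alpha> \<beta> M C = class_zero_part \<psi> \<phi> \<alpha> \<beta> M C + sum_submodules C M"

end

theory Submission
  imports Defs
begin

text \<open>
  The twists can be undone. As \<open>\<psi>\<close> and \<open>\<alpha>\<close> are bijective,
  the inclusion of \<open>\<psi> ` M g\<close> in \<open>M (\<alpha> g)\<close> is an equality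
  (lemma \<open>image_component\<close>), and likewise for \<open>\<phi>\<close> and \<open>\<beta>\<close>. So a
  product of matrices of degrees \<open>g\<close> and \<open>h\<close> is a twisted product of matrices of degrees
  \<open>inv \<alpha> g\<close> and \<open>inv \<beta> h\<close>, and has degree \<open>g + h\<close>: the grading is
  one of the ordinary associative algebra. The zero part of a class is then the span of the products
  of its opposite components, the condition on \<open>M 0\<close> says that all such products span
  \<open>M 0\<close>, and a matrix all of whose ordinary products vanish lies in the centre.

  On the other side, being connected is the equivalence relation on the support that is generated by
  \<open>g \<sim> \<alpha> g\<close>, \<open>g \<sim> \<beta> g\<close>, \<open>g \<sim> - g\<close> and
  \<open>g \<sim> g + u\<close> (theorem \<open>conn_rel_eq\<close>). It is used through one consequence: if
  homogeneous matrices of nonzero degrees have a nonzero product, then their degrees are connected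
  (lemma \<open>nonzero_product_related\<close>), because the sum of the degrees either is zero or lies in
  the support and is connected with both. From this and associativity, the submodules attached to
  the classes are ideals, and two different ones annihilate each other. They span the algebra by the
  condition on \<open>M 0\<close>. A matrix that lies in one of them and in the sum of the others
  annihilates everything, so it is zero because the centre is.
\<close>

section \<open>The matrix algebra\<close>

text \<open>A finite index range turns the sum over all indices into an ordinary one, so that the ring
  laws below reduce to the calculus of finite sums.\<close>

lemma lookup_mat_mult_finite:
  fixes A B :: "('i, 'r::comm_ring) fmat"
  assumes "finite F" and "snd ` Poly_Mapping.keys A \<subseteq> F"
  shows "Poly_Mapping.lookup (mat_mult A B) (i, k) =
    (\<Sum>j\<in>F. Poly_Mapping.lookup A (i, j) * Poly_Mapping.lookup B (j, k))"
proof -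
  have "{j. Poly_Mapping.lookup A (i, j) * Poly_Mapping.lookup B (j, k) \<noteq> 0} \<subseteq> F"
  proof
    fix j assume "j \<in> {j. Poly_Mapping.lookup A (i, j) * Poly_Mapping.lookup B (j, k) \<noteq> 0}"
    then have "(i, j) \<in> Poly_Mapping.keys A"
      by (auto simp: in_keys_iff)
    then show "j \<in> F"
      using assms(2) by force
  qed
  then show ?thesis
    by (simp add: lookup_mat_mult(1) Sum_any.expand_superset[OF assms(1)])
qed

lemma keys_mat_mult:
  fixes A B :: "('i, 'r::comm_ring) fmat"
  shows "Poly_Mapping.keys (mat_mult A B)
    \<subseteq> fst ` Poly_Mapping.keys A \<times> snd ` Poly_Mapping.keys B"
proof
  fix p assume "p \<in> Poly_Mapping.keys (mat_mult A B)"
  moreover obtain i k where p: "p = (i, k)"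
    by (cases p)
  ultimately have "Sum_any (\<lambda>j. Poly_Mapping.lookup A (i, j) * Poly_Mapping.lookup B (j, k)) \<noteq> 0"
    by (simp add: in_keys_iff lookup_mat_mult(1))
  then obtain j where "Poly_Mapping.lookup A (i, j) * Poly_Mapping.lookup B (j, k) \<noteq> 0"
    by (rule Sum_any.not_neutral_obtains_not_neutral)
  then have "(i, j) \<in> Poly_Mapping.keys A" "(j, k) \<in> Poly_Mapping.keys B"
    by (auto simp: in_keys_iff)
  then show "p \<in> fst ` Poly_Mapping.keys A \<times> snd ` Poly_Mapping.keys B"
    unfolding p by (metis SigmaI fst_conv image_eqI snd_conv)
qed

lemma lookup_mat_scale:
  "Poly_Mapping.lookup (mat_scale r A) p = r * Poly_Mapping.lookup A p"
  by (simp add: mat_scale_def Poly_Mapping.map.rep_eq when_def)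

lemma mat_mult_add_left:
  fixes A B C :: "('i, 'r::comm_ring) fmat"
  shows "mat_mult (A + B) C = mat_mult A C + mat_mult B C"
proof (rule poly_mapping_eqI)
  fix p :: "'i \<times> 'i"
  obtain i k where p: "p = (i, k)" by (cases p)
  let ?F = "snd ` (Poly_Mapping.keys A \<union> Poly_Mapping.keys B)"
  have "snd ` Poly_Mapping.keys (A + B) \<subseteq> ?F"
    using keys_add[of A B] by blast
  then show "Poly_Mapping.lookup (mat_mult (A + B) C) p =
      Poly_Mapping.lookup (mat_mult A C + mat_mult B C) p"
    unfolding p lookup_add
    by (subst (1 2 3) lookup_mat_mult_finite[where F = ?F])
       (auto simp: lookup_add algebra_simps sum.distrib)
qed

lemma mat_mult_add_right:
  fixes A B C :: "('i, 'r::comm_ring) fmat"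
  shows "mat_mult C (A + B) = mat_mult C A + mat_mult C B"
proof (rule poly_mapping_eqI)
  fix p :: "'i \<times> 'i"
  obtain i k where p: "p = (i, k)" by (cases p)
  show "Poly_Mapping.lookup (mat_mult C (A + B)) p =
      Poly_Mapping.lookup (mat_mult C A + mat_mult C B) p"
    unfolding p lookup_add
    by (subst (1 2 3) lookup_mat_mult_finite[where F = "snd ` Poly_Mapping.keys C"])
       (auto simp: lookup_add algebra_simps sum.distrib)
qed

lemma mat_mult_scale_left:
  fixes A C :: "('i, 'r::comm_ring) fmat"
  shows "mat_mult (mat_scale r A) C = mat_scale r (mat_mult A C)"
proof (rule poly_mapping_eqI)
  fix p :: "'i \<times> 'i"
  obtain i k where p: "p = (i, k)" by (cases p)
  let ?F = "snd ` Poly_Mapping.keys A"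
  have "Poly_Mapping.keys (mat_scale r A) \<subseteq> Poly_Mapping.keys A"
    by (auto simp: in_keys_iff lookup_mat_scale)
  then have "snd ` Poly_Mapping.keys (mat_scale r A) \<subseteq> ?F"
    by blast
  then show "Poly_Mapping.lookup (mat_mult (mat_scale r A) C) p =
      Poly_Mapping.lookup (mat_scale r (mat_mult A C)) p"
    unfolding p lookup_mat_scale
    by (subst (1 2) lookup_mat_mult_finite[where F = ?F])
       (auto simp: lookup_mat_scale sum_distrib_left mult.assoc)
qed

lemma mat_mult_scale_right:
  fixes A C :: "('i, 'r::comm_ring) fmat"
  shows "mat_mult C (mat_scale r A) = mat_scale r (mat_mult C A)"
proof (rule poly_mapping_eqI)
  fix p :: "'i \<times> 'i"
  obtain i k where p: "p = (i, k)" by (cases p)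
  show "Poly_Mapping.lookup (mat_mult C (mat_scale r A)) p =
      Poly_Mapping.lookup (mat_scale r (mat_mult C A)) p"
    unfolding p lookup_mat_scale
    by (subst (1 2) lookup_mat_mult_finite[where F = "snd ` Poly_Mapping.keys C"])
       (auto simp: lookup_mat_scale sum_distrib_left ac_simps)
qed

lemma mat_mult_assoc:
  fixes A B C :: "('i, 'r::comm_ring) fmat"
  shows "mat_mult (mat_mult A B) C = mat_mult A (mat_mult B C)"
proof (rule poly_mapping_eqI)
  fix p :: "'i \<times> 'i"
  obtain i l where p: "p = (i, l)" by (cases p)
  let ?a = "Poly_Mapping.lookup A" and ?b = "Poly_Mapping.lookup B"
    and ?c = "Poly_Mapping.lookup C"
  let ?F = "snd ` Poly_Mapping.keys A" and ?H = "snd ` Poly_Mapping.keys B"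
  have "snd ` Poly_Mapping.keys (mat_mult A B) \<subseteq> ?H"
    using keys_mat_mult[of A B] by fastforce
  then have "Poly_Mapping.lookup (mat_mult (mat_mult A B) C) (i, l) =
      (\<Sum>k\<in>?H. (\<Sum>j\<in>?F. ?a (i, j) * ?b (j, k)) * ?c (k, l))"
    by (simp add: lookup_mat_mult_finite[where F = ?H and A = "mat_mult A B"]
        lookup_mat_mult_finite[where F = ?F and A = A])
  also have "\<dots> = (\<Sum>j\<in>?F. ?a (i, j) * (\<Sum>k\<in>?H. ?b (j, k) * ?c (k, l)))"
    unfolding sum_distrib_left sum_distrib_right mult.assoc by (rule sum.swap)
  also have "\<dots> = Poly_Mapping.lookup (mat_mult A (mat_mult B C)) (i, l)"
    by (simp add: lookup_mat_mult_finite[where F = ?F and A = A]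
        lookup_mat_mult_finite[where F = ?H and A = B])
  finally show "Poly_Mapping.lookup (mat_mult (mat_mult A B) C) p =
      Poly_Mapping.lookup (mat_mult A (mat_mult B C)) p"
    by (simp add: p)
qed

lemma mat_mult_zero [simp]: "mat_mult 0 A = 0" "mat_mult A 0 = 0"
  using mat_mult_add_left[of 0 0 A] mat_mult_add_right[of A 0 0] by simp_all

lemma mat_mult_minus_left: "mat_mult (- A) B = - mat_mult A B"
  using mat_mult_add_left[of A "- A" B] by (simp add: eq_neg_iff_add_eq_0 add.commute)

lemma mat_mult_minus_right: "mat_mult A (- B) = - mat_mult A B"
  using mat_mult_add_right[of A B "- B"] by (simp add: eq_neg_iff_add_eq_0 add.commute)

lemma mat_scale_zero [simp]: "mat_scale r 0 = 0"
  by (rule poly_mapping_eqI) (simp add: lookup_mat_scale)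

lemma mat_scale_add: "mat_scale r (A + B) = mat_scale r A + mat_scale r B"
  by (rule poly_mapping_eqI) (simp add: lookup_mat_scale lookup_add distrib_left)


section \<open>Submodules and spans\<close>

lemma is_submoduleI:
  assumes "0 \<in> S" "\<And>A B. A \<in> S \<Longrightarrow> B \<in> S \<Longrightarrow> A + B \<in> S" "\<And>A. A \<in> S \<Longrightarrow> - A \<in> S"
    "\<And>r A. A \<in> S \<Longrightarrow> mat_scale r A \<in> S"
  shows "is_submodule S"
  using assms by (simp add: is_submodule_def)

lemma is_submoduleD:
  assumes "is_submodule S"
  shows "0 \<in> S" "\<And>A B. A \<in> S \<Longrightarrow> B \<in> S \<Longrightarrow> A + B \<in> S" "\<And>A. A \<in> S \<Longrightarrow> - A \<in> S"
    "\<And>r A. A \<in> S \<Longrightarrow> mat_scale r A \<in> S"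
  using assms by (simp_all add: is_submodule_def)

lemma is_submodule_diff: "is_submodule S \<Longrightarrow> A \<in> S \<Longrightarrow> B \<in> S \<Longrightarrow> A - B \<in> S"
  using is_submoduleD(2,3)[of S] by (metis diff_conv_add_uminus)

lemma is_submodule_sum:
  assumes "is_submodule S" "\<And>j. j \<in> K \<Longrightarrow> f j \<in> S"
  shows "(\<Sum>j\<in>K. f j) \<in> S"
  using assms(2) by (induction K rule: infinite_finite_induct) (auto intro: is_submoduleD[OF assms(1)])

lemma is_submodule_Int: "is_submodule S \<Longrightarrow> is_submodule T \<Longrightarrow> is_submodule (S \<inter> T)"
  by (auto simp: is_submodule_def)

lemma is_submodule_Mat: "is_submodule (Mat I)"
proof (rule is_submoduleI)
  fix A B :: "('a, 'b) fmat" assume "A \<in> Mat I" "B \<in> Mat I"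
  then show "A + B \<in> Mat I"
    using keys_add[of A B] by (auto simp: Mat_def)
next
  fix r A assume "A \<in> Mat I"
  moreover have "Poly_Mapping.keys (mat_scale r A) \<subseteq> Poly_Mapping.keys A"
    by (auto simp: in_keys_iff lookup_mat_scale)
  ultimately show "mat_scale r A \<in> Mat I"
    by (auto simp: Mat_def)
qed (auto simp: Mat_def)

lemma is_submodule_span: "is_submodule (mat_span X)"
  unfolding mat_span_def by (rule hull_in) (auto simp: is_submodule_def)

lemma span_superset: "X \<subseteq> mat_span X"
  unfolding mat_span_def by (rule hull_subset)

lemma span_minimal: "is_submodule S \<Longrightarrow> X \<subseteq> S \<Longrightarrow> mat_span X \<subseteq> S"
  unfolding mat_span_def by (rule hull_minimal)

lemma span_mono: "X \<subseteq> Y \<Longrightarrow> mat_span X \<subseteq> mat_span Y"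
  unfolding mat_span_def by (rule hull_mono)

lemma span_UN_span: "mat_span (\<Union>j\<in>J. mat_span (X j)) = mat_span (\<Union>j\<in>J. X j)"
proof (rule equalityI)
  show "mat_span (\<Union>j\<in>J. mat_span (X j)) \<subseteq> mat_span (\<Union>j\<in>J. X j)"
    by (intro span_minimal is_submodule_span UN_least span_mono) blast
  show "mat_span (\<Union>j\<in>J. X j) \<subseteq> mat_span (\<Union>j\<in>J. mat_span (X j))"
    using span_superset by (intro span_mono) blast
qed

lemma span_plus_span: "mat_span X + mat_span Y = mat_span (X \<union> Y)"
proof (rule equalityI)
  show "mat_span X + mat_span Y \<subseteq> mat_span (X \<union> Y)"
    using span_mono[of X "X \<union> Y"] span_mono[of Y "X \<union> Y"]
    by (auto simp: set_plus_def intro: is_submoduleD(2)[OF is_submodule_span])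
  note X = is_submoduleD[OF is_submodule_span[of X]]
  note Y = is_submoduleD[OF is_submodule_span[of Y]]
  have "is_submodule (mat_span X + mat_span Y)"
  proof (rule is_submoduleI)
    show "0 \<in> mat_span X + mat_span Y"
      using set_plus_intro[OF X(1) Y(1)] by simp
  next
    fix A B assume "A \<in> mat_span X + mat_span Y" "B \<in> mat_span X + mat_span Y"
    then obtain a b c d where "A = a + b" "B = c + d" "a \<in> mat_span X" "c \<in> mat_span X"
      "b \<in> mat_span Y" "d \<in> mat_span Y"
      by (auto elim!: set_plus_elim)
    then show "A + B \<in> mat_span X + mat_span Y"
      using set_plus_intro[OF X(2) Y(2), of a c b d] by (simp add: ac_simps)
  next
    fix A assume "A \<in> mat_span X + mat_span Y"
    then obtain a b where "A = a + b" "a \<in> mat_span X" "b \<in> mat_span Y"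
      by (auto elim!: set_plus_elim)
    then show "- A \<in> mat_span X + mat_span Y"
      using set_plus_intro[OF X(3) Y(3), of a b] by simp
  next
    fix r A assume "A \<in> mat_span X + mat_span Y"
    then obtain a b where "A = a + b" "a \<in> mat_span X" "b \<in> mat_span Y"
      by (auto elim!: set_plus_elim)
    then show "mat_scale r A \<in> mat_span X + mat_span Y"
      using set_plus_intro[OF X(4) Y(4), of a b] by (simp add: mat_scale_add)
  qed
  moreover have "X \<subseteq> mat_span X + mat_span Y" "Y \<subseteq> mat_span X + mat_span Y"
    using set_plus_intro[OF _ Y(1), of _ "mat_span X"] set_plus_intro[OF X(1), of _ "mat_span Y"]
      span_superset[of X] span_superset[of Y] by auto
  ultimately show "mat_span (X \<union> Y) \<subseteq> mat_span X + mat_span Y"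
    by (intro span_minimal) auto
qed

text \<open>The set below is a submodule by bilinearity. Statements about products of arbitrary
  elements of two spans are therefore decided on generators, one factor at a time.\<close>

lemma is_submodule_multipliers:
  assumes "is_submodule J"
  shows "is_submodule {x. \<forall>y\<in>Y. mat_mult x y \<in> J \<and> mat_mult y x \<in> J}"
  using is_submoduleD[OF assms]
  by (intro is_submoduleI)
     (auto simp: mat_mult_add_left mat_mult_add_right mat_mult_minus_left mat_mult_minus_right
        mat_mult_scale_left mat_mult_scale_right)

lemma span_mult_mem:
  assumes J: "is_submodule J"
    and gens: "\<And>x y. x \<in> X \<Longrightarrow> y \<in> Y \<Longrightarrow> mat_mult x y \<in> J \<and> mat_mult y x \<in> J"
    and "x \<in> mat_span X" "y \<in> mat_span Y"
  shows "mat_mult x y \<in> J" "mat_mult y x \<in> J"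
proof -
  have "mat_span X \<subseteq> {x. \<forall>y\<in>Y. mat_mult x y \<in> J \<and> mat_mult y x \<in> J}"
    using gens by (intro span_minimal is_submodule_multipliers J) blast
  then have "mat_span Y \<subseteq> {y. \<forall>x\<in>mat_span X. mat_mult y x \<in> J \<and> mat_mult x y \<in> J}"
    by (intro span_minimal is_submodule_multipliers J) blast
  then show "mat_mult x y \<in> J" "mat_mult y x \<in> J"
    using assms(3,4) by blast+
qed

lemma is_direct_sum_cong:
  assumes "\<And>j. j \<in> J \<Longrightarrow> F j = F' j"
  shows "is_direct_sum T J F \<longleftrightarrow> is_direct_sum T J F'"
  using assms unfolding is_direct_sum_def sum_submodules_def by (simp add: subset_iff cong: conj_cong)

lemma is_submodule_zero: "is_submodule {0}"
  by (rule is_submoduleI) auto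


section \<open>Graded matrix algebras\<close>

locale graded_mat =
  fixes I :: "'i set" and M :: "'g::ab_group_add \<Rightarrow> ('i, 'r::comm_ring) fmat set"
  assumes direct: "is_direct_sum (Mat I) UNIV M"
begin

lemma submodule_M: "is_submodule (M g)"
  using direct by (simp add: is_direct_sum_def)

lemma Mat_eq_span: "Mat I = mat_span (\<Union>g. M g)"
  using direct by (simp add: is_direct_sum_def sum_submodules_def)

lemma M_subset_Mat: "M g \<subseteq> Mat I"
  using span_superset[of "\<Union>g. M g"] by (auto simp: Mat_eq_span)

lemma independent:
  assumes "finite K" "\<And>j. j \<in> K \<Longrightarrow> x j \<in> M j" "(\<Sum>j\<in>K. x j) = 0" "k \<in> K"
  shows "x k = 0"
  using direct assms unfolding is_direct_sum_def by blast

lemma supportI: "x \<in> M g \<Longrightarrow> x \<noteq> 0 \<Longrightarrow> g \<noteq> 0 \<Longrightarrow> g \<in> support M"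
  by (auto simp: support_def)

lemma homogeneous_decomposition:
  assumes "x \<in> Mat I"
  shows "\<exists>K y. finite K \<and> (\<forall>g. y g \<in> M g) \<and> x = (\<Sum>g\<in>K. y g)"
proof -
  let ?S = "{x. \<exists>K y. finite K \<and> (\<forall>g. y g \<in> M g) \<and> x = (\<Sum>g\<in>K. y g)}"
  note M = is_submoduleD[OF submodule_M]
  have "is_submodule ?S"
  proof (rule is_submoduleI)
    show "0 \<in> ?S"
      using M(1) by (auto intro!: exI[of _ "{}"] exI[of _ "\<lambda>_. 0"])
  next
    fix A B assume "A \<in> ?S" "B \<in> ?S"
    then obtain K L y z where *: "finite K" "finite L" "\<forall>g. y g \<in> M g" "\<forall>g. z g \<in> M g"
      "A = (\<Sum>g\<in>K. y g)" "B = (\<Sum>g\<in>L. z g)" by auto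
    \<comment> \<open>Both sums are extended by zero to the union of the two index sets.\<close>
    let ?y = "\<lambda>g. (if g \<in> K then y g else 0) + (if g \<in> L then z g else 0)"
    have "A = (\<Sum>g\<in>K \<union> L. if g \<in> K then y g else 0)" "B = (\<Sum>g\<in>K \<union> L. if g \<in> L then z g else 0)"
      unfolding *(5,6) using *(1,2) by (auto intro!: sum.mono_neutral_cong_left)
    then have "A + B = (\<Sum>g\<in>K \<union> L. ?y g)"
      by (simp add: sum.distrib)
    moreover have "\<forall>g. ?y g \<in> M g"
      using * M by auto
    ultimately show "A + B \<in> ?S"
      using *(1,2) by (intro CollectI exI[of _ "K \<union> L"] exI[of _ ?y]) simp
  next
    fix A assume "A \<in> ?S"
    then obtain K y where "finite K" "\<forall>g. y g \<in> M g" "A = (\<Sum>g\<in>K. y g)" by auto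
    then show "- A \<in> ?S"
      using M(3) by (intro CollectI exI[of _ K] exI[of _ "\<lambda>g. - y g"]) (simp add: sum_negf)
  next
    fix r A assume "A \<in> ?S"
    then obtain K y where *: "finite K" "\<forall>g. y g \<in> M g" "A = (\<Sum>g\<in>K. y g)" by auto
    have "mat_scale r (\<Sum>g\<in>K. y g) = (\<Sum>g\<in>K. mat_scale r (y g))"
      using *(1) by (induction K rule: finite_induct) (simp_all add: mat_scale_add)
    then show "mat_scale r A \<in> ?S"
      using * M(4) by (intro CollectI exI[of _ K] exI[of _ "\<lambda>g. mat_scale r (y g)"]) simp
  qed
  moreover have "(\<Union>g. M g) \<subseteq> ?S"
  proof clarify
    fix x g assume "x \<in> M g"
    then show "\<exists>K y. finite K \<and> (\<forall>g. y g \<in> M g) \<and> x = (\<Sum>g\<in>K. y g)"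
      using M(1) by (intro exI[of _ "{g}"] exI[of _ "\<lambda>h. if h = g then x else 0"]) auto
  qed
  ultimately have "Mat I \<subseteq> ?S"
    unfolding Mat_eq_span by (rule span_minimal)
  then show ?thesis
    using assms by blast
qed

lemma span_homogeneous_graded:
  assumes "X \<subseteq> (\<Union>g. M g)"
  shows "is_direct_sum (mat_span X) UNIV (\<lambda>g. mat_span X \<inter> M g)"
proof -
  have "mat_span X \<subseteq> mat_span (\<Union>g. mat_span X \<inter> M g)"
    using assms span_superset[of X] by (intro span_mono) blast
  moreover have "mat_span (\<Union>g. mat_span X \<inter> M g) \<subseteq> mat_span X"
    by (intro span_minimal is_submodule_span) blast
  ultimately show ?thesis
    using independent unfolding is_direct_sum_def sum_submodules_def
    by (auto intro!: is_submodule_Int is_submodule_span submodule_M)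
qed

end

locale degree_shift = graded_mat I M
  for I :: "'i set" and M :: "'g::ab_group_add \<Rightarrow> ('i, 'r::comm_ring) fmat set" +
  fixes f :: "('i, 'r::comm_ring) fmat \<Rightarrow> ('i, 'r) fmat" and \<gamma> :: "'g::ab_group_add \<Rightarrow> 'g"
  assumes aut: "mat_automorphism I f" and grp: "group_automorphism \<gamma>"
    and shift: "f ` M g \<subseteq> M (\<gamma> g)"
begin

lemma f_add: "x \<in> Mat I \<Longrightarrow> y \<in> Mat I \<Longrightarrow> f (x + y) = f x + f y"
  and f_scale: "x \<in> Mat I \<Longrightarrow> f (mat_scale r x) = mat_scale r (f x)"
  and f_mult: "x \<in> Mat I \<Longrightarrow> y \<in> Mat I \<Longrightarrow> f (mat_mult x y) = mat_mult (f x) (f y)"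
  and f_bij: "bij_betw f (Mat I) (Mat I)"
  using aut by (simp_all add: mat_automorphism_def)

lemma f_mem: "x \<in> Mat I \<Longrightarrow> f x \<in> Mat I"
  using f_bij by (auto simp: bij_betw_def)

lemma f_zero: "f 0 = 0"
  using f_add[of 0 0] is_submoduleD(1)[OF is_submodule_Mat[of I]] by simp

lemma f_minus: "x \<in> Mat I \<Longrightarrow> f (- x) = - f x"
  using f_add[of "- x" x] f_zero is_submoduleD(3)[OF is_submodule_Mat[of I], of x]
  by (simp add: eq_neg_iff_add_eq_0)

lemma f_sum: "(\<And>j. j \<in> K \<Longrightarrow> y j \<in> Mat I) \<Longrightarrow> f (\<Sum>j\<in>K. y j) = (\<Sum>j\<in>K. f (y j))"
proof (induction K rule: infinite_finite_induct)
  case (insert j K)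
  then show ?case
    by (simp add: f_add is_submodule_sum[OF is_submodule_Mat])
qed (simp_all add: f_zero)

lemma additive_\<gamma>: "additive \<gamma>" and bij_\<gamma>: "bij \<gamma>"
  using grp by (simp_all add: group_automorphism_def)

text \<open>The homogeneous parts of a preimage are sent to different degrees. So if the image is
  homogeneous, then it is the image of a single part.\<close>

lemma image_component: "f ` M g = M (\<gamma> g)"
proof
  show "M (\<gamma> g) \<subseteq> f ` M g"
  proof
    fix x assume x: "x \<in> M (\<gamma> g)"
    then obtain y where y: "y \<in> Mat I" "x = f y"
      using M_subset_Mat f_bij by (metis bij_betw_iff_bijections subsetD)
    from homogeneous_decomposition[OF y(1)] obtain K z where
      K0: "finite K" "\<And>h. z h \<in> M h" "y = (\<Sum>h\<in>K. z h)" by blast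
    \<comment> \<open>The degree of x itself is made to occur in the decomposition.\<close>
    define w where "w h = (if h \<in> K then z h else 0)" for h
    have w: "w h \<in> M h" for h
      using K0(2) is_submoduleD(1)[OF submodule_M] by (simp add: w_def)
    let ?K = "insert g K"
    have "y = (\<Sum>h\<in>?K. w h)"
      unfolding K0(3) using K0(1) by (intro sum.mono_neutral_cong_left) (auto simp: w_def)
    then have "x = (\<Sum>h\<in>?K. f (w h))"
      using y(2) w M_subset_Mat by (subst f_sum[symmetric]) auto
    then have "x = (\<Sum>h\<in>\<gamma> ` ?K. f (w (inv \<gamma> h)))"
      using bij_\<gamma> by (subst sum.reindex) (auto simp: bij_def inj_def inj_on_def)
    moreover define d where "d h = f (w (inv \<gamma> h)) - (if h = \<gamma> g then x else 0)" for h
    ultimately have "(\<Sum>h\<in>\<gamma> ` ?K. d h) = 0"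
      using K0(1) by (simp add: sum_subtractf)
    moreover have "d h \<in> M h" for h
    proof -
      have "f (w (inv \<gamma> h)) \<in> M h"
        using shift[of "inv \<gamma> h"] w[of "inv \<gamma> h"] bij_\<gamma> by (auto simp: bij_is_surj surj_f_inv_f)
      then show ?thesis
        using x is_submoduleD(1)[OF submodule_M[of h]] is_submodule_diff[OF submodule_M]
        by (simp add: d_def)
    qed
    ultimately have "d (\<gamma> g) = 0"
      using K0(1) independent[of "\<gamma> ` ?K" d "\<gamma> g"] by simp
    then have "x = f (w g)"
      using bij_\<gamma> by (simp add: d_def bij_is_inj inv_f_f)
    then show "x \<in> f ` M g"
      using w by blast
  qed
qed (rule shift)

lemma support_shift: "\<gamma> g \<in> support M \<longleftrightarrow> g \<in> support M"
proof -
  have "\<gamma> g = 0 \<longleftrightarrow> g = 0"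
    using bij_\<gamma> additive.zero[OF additive_\<gamma>] by (metis bij_pointE)
  moreover have "M (\<gamma> g) = {0} \<longleftrightarrow> M g = {0}"
  proof
    assume "M (\<gamma> g) = {0}"
    then have "\<forall>x\<in>M g. f x = f 0"
      using image_component[of g] f_zero by auto
    then have "\<forall>x\<in>M g. x = 0"
      using f_bij M_subset_Mat is_submoduleD(1)[OF is_submodule_Mat[of I]]
      unfolding bij_betw_def inj_on_def by blast
    then show "M g = {0}"
      using is_submoduleD(1)[OF submodule_M] by blast
  next
    assume "M g = {0}"
    then show "M (\<gamma> g) = {0}"
      using image_component[of g] f_zero by simp
  qed
  ultimately show ?thesis
    by (simp add: support_def)
qed

lemma image_span:
  assumes "X \<subseteq> Mat I"
  shows "f ` mat_span X = mat_span (f ` X)"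
proof
  have XI: "mat_span X \<subseteq> Mat I"
    using assms is_submodule_Mat by (intro span_minimal)
  have "is_submodule {x \<in> Mat I. f x \<in> mat_span (f ` X)}"
    using is_submoduleD[OF is_submodule_Mat[of I]] is_submoduleD[OF is_submodule_span[of "f ` X"]]
    by (intro is_submoduleI) (auto simp: f_zero f_add f_minus f_scale)
  then have "mat_span X \<subseteq> {x \<in> Mat I. f x \<in> mat_span (f ` X)}"
    using assms span_superset[of "f ` X"] by (intro span_minimal) auto
  then show "f ` mat_span X \<subseteq> mat_span (f ` X)"
    by blast
  note X = is_submoduleD[OF is_submodule_span[of X]]
  have "is_submodule (f ` mat_span X)"
  proof (rule is_submoduleI)
    show "0 \<in> f ` mat_span X"
      using X(1) f_zero by (metis imageI)
  next
    fix A B assume "A \<in> f ` mat_span X" "B \<in> f ` mat_span X"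
    then obtain a b where ab: "a \<in> mat_span X" "b \<in> mat_span X" "A = f a" "B = f b" by blast
    then have "A + B = f (a + b)"
      using subsetD[OF XI] f_add by simp
    then show "A + B \<in> f ` mat_span X"
      using X(2)[OF ab(1,2)] by blast
  next
    fix A assume "A \<in> f ` mat_span X"
    then obtain a where a: "a \<in> mat_span X" "A = f a" by blast
    then have "- A = f (- a)"
      using XI f_minus by fastforce
    then show "- A \<in> f ` mat_span X"
      using X(3)[OF a(1)] by blast
  next
    fix r A assume "A \<in> f ` mat_span X"
    then obtain a where a: "a \<in> mat_span X" "A = f a" by blast
    then have "mat_scale r A = f (mat_scale r a)"
      using XI f_scale by fastforce
    then show "mat_scale r A \<in> f ` mat_span X"
      using X(4)[OF a(1)] by blast
  qed
  then show "mat_span (f ` X) \<subseteq> f ` mat_span X"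
    using span_superset[of X] by (intro span_minimal) auto
qed

end


section \<open>Blocks of a graded algebra\<close>

text \<open>In the decomposition of the theorem, \<open>E\<close> is the relation of being connected. Any
  equivalence relation with the properties \<open>E_neg\<close> and \<open>E_add\<close> cuts the algebra into blocks, so
  the combinatorics of connections stays separate from the algebra.\<close>

locale graded_blocks = graded_mat I M
  for I :: "'i set" and M :: "'g::ab_group_add \<Rightarrow> ('i, 'r::comm_ring) fmat set" +
  fixes E :: "('g \<times> 'g) set"
  assumes mult_mem: "x \<in> M g \<Longrightarrow> y \<in> M h \<Longrightarrow> mat_mult x y \<in> M (g + h)"
    and equiv_E: "equiv (support M) E"
    and E_neg: "g \<in> support M \<Longrightarrow> (g, - g) \<in> E"
    and E_add: "g \<in> support M \<Longrightarrow> h \<in> support M \<Longrightarrow> g + h \<in> support M \<Longrightarrow> (g, g + h) \<in> E"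
begin

text \<open>For a class these homogeneous generators span the submodule that the theorem attaches to it.
  Naming them allows statements about blocks to be checked on single products.\<close>

definition block_gens :: "'g set \<Rightarrow> ('i, 'r) fmat set" where
  "block_gens C = (\<Union>g\<in>C. M g \<union> {mat_mult a b | a b. a \<in> M g \<and> b \<in> M (- g)})"

definition block :: "'g set \<Rightarrow> ('i, 'r) fmat set" where
  "block C = mat_span (block_gens C)"

lemma block_gens_cases:
  assumes "x \<in> block_gens C"
  obtains g where "g \<in> C" "x \<in> M g"
  | g a b where "g \<in> C" "a \<in> M g" "b \<in> M (- g)" "x = mat_mult a b"
  using assms unfolding block_gens_def by blast

lemma component_in_block: "g \<in> C \<Longrightarrow> M g \<subseteq> block C"
  using span_superset[of "block_gens C"] unfolding block_def by (auto simp: block_gens_def)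

lemma product_in_block: "g \<in> C \<Longrightarrow> a \<in> M g \<Longrightarrow> b \<in> M (- g) \<Longrightarrow> mat_mult a b \<in> block C"
  using span_superset[of "block_gens C"] unfolding block_def block_gens_def by blast

lemma submodule_block: "is_submodule (block C)"
  unfolding block_def by (rule is_submodule_span)

lemma block_gens_homogeneous: "block_gens C \<subseteq> (\<Union>g. M g)"
  unfolding block_gens_def using mult_mem by blast

lemma block_subset_Mat: "block C \<subseteq> Mat I"
  unfolding block_def Mat_eq_span by (rule span_mono[OF block_gens_homogeneous])

text \<open>A nonzero product has degree zero or a degree in the support. In the first case the degrees of
  the factors are opposite, in the second both are related to their sum.\<close>

lemma nonzero_product_related:
  assumes "x \<in> M g" "y \<in> M h" "mat_mult x y \<noteq> 0" "g \<noteq> 0" "h \<noteq> 0"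
  shows "(g, h) \<in> E"
proof -
  have supp: "g \<in> support M" "h \<in> support M"
    using assms by (auto intro: supportI)
  show ?thesis
  proof (cases "g + h = 0")
    case True
    then have "h = - g"
      by (simp add: eq_neg_iff_add_eq_0 add.commute)
    then show ?thesis
      using E_neg supp by simp
  next
    case False
    then have "g + h \<in> support M"
      using mult_mem assms by (intro supportI[of "mat_mult x y"])
    then have "(g, g + h) \<in> E" "(h, g + h) \<in> E"
      using E_add[of g h] E_add[of h g] supp by (simp_all add: add.commute)
    then show ?thesis
      using equiv_E by (meson equivE symD transD)
  qed
qed

lemma class_closed: "C \<in> support M // E \<Longrightarrow> g \<in> C \<Longrightarrow> (g, h) \<in> E \<Longrightarrow> h \<in> C"
  using equiv_E by (metis in_quotient_imp_closed)

lemma class_subset: "C \<in> support M // E \<Longrightarrow> C \<subseteq> support M"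
  using equiv_E by (rule in_quotient_imp_subset)

lemma class_nonzero: "C \<in> support M // E \<Longrightarrow> g \<in> C \<Longrightarrow> g \<noteq> 0"
  using class_subset by (auto simp: support_def)

lemma class_neg: "C \<in> support M // E \<Longrightarrow> g \<in> C \<Longrightarrow> - g \<in> C"
  using class_closed class_subset E_neg by blast

lemma component_mult_in_block:
  assumes C: "C \<in> support M // E" and x: "x \<in> M g" and y: "y \<in> M h" and gh: "g \<in> C \<or> h \<in> C"
  shows "mat_mult x y \<in> block C"
proof -
  have xy: "mat_mult x y \<in> M (g + h)"
    using mult_mem[OF x y] .
  consider "mat_mult x y = 0" | "g = 0" | "h = 0"
    | "mat_mult x y \<noteq> 0" "g \<noteq> 0" "h \<noteq> 0" by blast
  then show ?thesis
  proof cases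
    case 1
    then show ?thesis
      using is_submoduleD(1)[OF submodule_block] by simp
  next
    case 2
    then show ?thesis
      using gh class_nonzero[OF C] xy component_in_block by auto
  next
    case 3
    then show ?thesis
      using gh class_nonzero[OF C] xy component_in_block by auto
  next
    case 4
    have "(g, h) \<in> E"
      using nonzero_product_related[OF x y] 4 by blast
    moreover from this have "(h, g) \<in> E"
      using equiv_E by (meson equivE symD)
    ultimately have C2: "g \<in> C" "h \<in> C"
      using gh class_closed[OF C] by blast+
    show ?thesis
    proof (cases "g + h = 0")
      case True
      then have "h = - g"
        by (simp add: eq_neg_iff_add_eq_0 add.commute)
      then show ?thesis
        using product_in_block[OF C2(1) x] y by simp
    next
      case False
      then have "g + h \<in> support M"
        using xy 4 by (intro supportI)
      then have "g + h \<in> C"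
        using E_add[of g h] class_closed[OF C] class_subset[OF C] C2 by blast
      then show ?thesis
        using component_in_block xy by blast
    qed
  qed
qed

text \<open>Products of a generator of degree zero regroup by associativity: if such a product with a
  matrix of nonzero degree \<open>h\<close> survives, then so does the inner product, whence \<open>h\<close> is
  in the class.\<close>

lemma block_gen_mult_in_block:
  assumes C: "C \<in> support M // E" and x: "x \<in> block_gens C" and y: "y \<in> M h"
  shows "mat_mult x y \<in> block C \<and> mat_mult y x \<in> block C"
  using x
proof (cases rule: block_gens_cases)
  case (1 g)
  then show ?thesis
    using component_mult_in_block[OF C] y by blast
next
  case (2 g a b)
  note zero = is_submoduleD(1)[OF submodule_block[of C]]
  note neg = class_neg[OF C 2(1)]
  have g0: "g \<noteq> 0" "- g \<noteq> 0"
    using class_nonzero[OF C] 2(1) by auto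
  have inC: "mat_mult x y \<in> block C" "mat_mult y x \<in> block C" if "h \<in> C"
    using component_in_block[OF that] mult_mem[OF mult_mem[OF 2(2,3)] y]
      mult_mem[OF y mult_mem[OF 2(2,3)]] 2(4) by auto
  have right: "mat_mult x y = mat_mult a (mat_mult b y)"
    by (simp add: 2(4) mat_mult_assoc)
  have left: "mat_mult y x = mat_mult (mat_mult y a) b"
    by (simp add: 2(4) mat_mult_assoc)
  have "mat_mult x y \<in> block C"
  proof (cases "h = 0 \<or> mat_mult b y = 0")
    case True
    then show ?thesis
      using product_in_block[OF 2(1,2)] mult_mem[OF 2(3) y] zero right by auto
  next
    case False
    then show ?thesis
      using nonzero_product_related[OF 2(3) y] g0 class_closed[OF C neg] inC by blast
  qed
  moreover have "mat_mult y x \<in> block C"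
  proof (cases "h = 0 \<or> mat_mult y a = 0")
    case True
    then show ?thesis
      using product_in_block[OF 2(1) _ 2(3)] mult_mem[OF y 2(2)] zero left by auto
  next
    case False
    then have "(h, g) \<in> E"
      using nonzero_product_related[OF y 2(2)] g0 by blast
    then have "(g, h) \<in> E"
      using equiv_E by (meson equivE symD)
    then show ?thesis
      using class_closed[OF C 2(1)] inC by blast
  qed
  ultimately show ?thesis ..
qed

lemma block_ideal:
  assumes C: "C \<in> support M // E" and x: "x \<in> block C" and y: "y \<in> Mat I"
  shows "mat_mult x y \<in> block C" "mat_mult y x \<in> block C"
  using span_mult_mem[of "block C" "block_gens C" "\<Union>g. M g" x y] block_gen_mult_in_block[OF C] x y
  by (auto simp: Mat_eq_span block_def is_submodule_span)

text \<open>Degrees from different classes are unrelated, so the corresponding components annihilate each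
  other. Associativity carries this over to the generators of degree zero.\<close>

lemma component_annihilates_block_gens:
  assumes C: "C \<in> support M // E" and D: "D \<in> support M // E" and ne: "C \<noteq> D"
    and x: "g \<in> C" "x \<in> M g" and y: "y \<in> block_gens D"
  shows "mat_mult x y = 0" "mat_mult y x = 0"
proof -
  have comp: "mat_mult x z = 0 \<and> mat_mult z x = 0" if h: "h \<in> D" "z \<in> M h" for h z
  proof -
    have "(g, h) \<notin> E" "(h, g) \<notin> E"
      using quotient_eqI[OF equiv_E C D] x(1) h(1) ne equiv_E by (meson equivE symD)+
    then show ?thesis
      using nonzero_product_related[OF x(2) h(2)] nonzero_product_related[OF h(2) x(2)]
        class_nonzero[OF C x(1)] class_nonzero[OF D h(1)] by blast
  qed
  have "mat_mult x y = 0 \<and> mat_mult y x = 0"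
    using y
  proof (cases rule: block_gens_cases)
    case (1 h)
    then show ?thesis using comp by blast
  next
    case (2 h a b)
    then have "mat_mult x a = 0" "mat_mult b x = 0"
      using comp class_neg[OF D] by blast+
    then show ?thesis
      using 2(4) mat_mult_assoc[of x a b] mat_mult_assoc[of a b x] by simp
  qed
  then show "mat_mult x y = 0" "mat_mult y x = 0" by auto
qed

lemma distinct_blocks_annihilate:
  assumes C: "C \<in> support M // E" and D: "D \<in> support M // E" and ne: "C \<noteq> D"
    and x: "x \<in> block C" and y: "y \<in> block D"
  shows "mat_mult x y = 0" "mat_mult y x = 0"
proof -
  have "mat_mult u v \<in> {0} \<and> mat_mult v u \<in> {0}"
    if u: "u \<in> block_gens C" and v: "v \<in> block_gens D" for u v
    using u
  proof (cases rule: block_gens_cases)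
    case (1 g)
    then show ?thesis
      using component_annihilates_block_gens[OF C D ne _ _ v] by blast
  next
    case (2 g a b)
    then have "mat_mult v a = 0" "mat_mult b v = 0"
      using component_annihilates_block_gens[OF C D ne _ _ v] class_neg[OF C] by blast+
    then show ?thesis
      using 2(4) mat_mult_assoc[of v a b] mat_mult_assoc[of a b v] by simp
  qed
  then show "mat_mult x y = 0" "mat_mult y x = 0"
    using span_mult_mem[OF is_submodule_zero, of "block_gens C" "block_gens D" x y] x y
    unfolding block_def by blast+
qed

lemma blocks_span:
  assumes zero: "M 0 \<subseteq> mat_span (\<Union>g\<in>support M. {mat_mult a b | a b. a \<in> M g \<and> b \<in> M (- g)})"
  shows "Mat I = mat_span (\<Union>C\<in>support M // E. block C)"
proof
  let ?T = "mat_span (\<Union>C\<in>support M // E. block C)"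
  have own_class: "\<exists>C\<in>support M // E. g \<in> C" if "g \<in> support M" for g
    using that equiv_E by (metis UnionE Union_quotient)
  have blockT: "block C \<subseteq> ?T" if "C \<in> support M // E" for C
    using that span_superset[of "\<Union>C\<in>support M // E. block C"] by blast
  have "mat_mult a b \<in> ?T" if "g \<in> support M" "a \<in> M g" "b \<in> M (- g)" for g a b
    using own_class[OF that(1)] product_in_block[OF _ that(2,3)] blockT by blast
  then have "mat_span (\<Union>g\<in>support M. {mat_mult a b | a b. a \<in> M g \<and> b \<in> M (- g)}) \<subseteq> ?T"
    by (intro span_minimal is_submodule_span) blast
  then have M0: "M 0 \<subseteq> ?T"
    using zero by blast
  have "M g \<subseteq> ?T" for g
  proof
    fix x assume x: "x \<in> M g"
    consider "x = 0" | "g = 0" | "g \<in> support M"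
      using supportI[OF x] by blast
    then show "x \<in> ?T"
    proof cases
      case 1
      then show ?thesis using is_submoduleD(1)[OF is_submodule_span] by simp
    next
      case 2
      then show ?thesis using x M0 by blast
    next
      case 3
      then show ?thesis using x own_class component_in_block blockT by blast
    qed
  qed
  then show "Mat I \<subseteq> ?T"
    unfolding Mat_eq_span by (intro span_minimal is_submodule_span) blast
  show "?T \<subseteq> Mat I"
    using block_subset_Mat by (intro span_minimal is_submodule_Mat) blast
qed

text \<open>If blocks add up to zero, then each summand lies both in its own block and in the sum of the
  others. It annihilates every block: its own by the second description, the others by the first.
  So it annihilates the whole algebra.\<close>

lemma blocks_direct:
  assumes span: "Mat I = mat_span (\<Union>C\<in>support M // E. block C)"
    and faithful: "\<And>v :: ('i, 'r) fmat. v \<in> Mat I \<Longrightarrow> (\<And>y. y \<in> Mat I \<Longrightarrow> mat_mult v y = 0) \<Longrightarrow>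
      (\<And>y. y \<in> Mat I \<Longrightarrow> mat_mult y v = 0) \<Longrightarrow> v = 0"
  shows "is_direct_sum (Mat I) (support M // E) block"
  unfolding is_direct_sum_def sum_submodules_def
proof (intro conjI ballI allI impI)
  fix K and x :: "'g set \<Rightarrow> ('i, 'r) fmat" and C
  assume "finite K \<and> K \<subseteq> support M // E \<and> (\<forall>C\<in>K. x C \<in> block C) \<and> (\<Sum>C\<in>K. x C) = 0"
  then have K: "finite K" "K \<subseteq> support M // E" and x: "\<And>C. C \<in> K \<Longrightarrow> x C \<in> block C"
    and sum0: "(\<Sum>C\<in>K. x C) = 0" by auto
  assume C: "C \<in> K"
  then have CQ: "C \<in> support M // E"
    using K by blast
  have "(\<Sum>D\<in>K. x D) = x C + (\<Sum>D\<in>K - {C}. x D)"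
    using K(1) C by (rule sum.remove)
  then have xC: "x C = - (\<Sum>D\<in>K - {C}. x D)"
    using sum0 by (simp add: eq_neg_iff_add_eq_0)
  let ?A = "\<lambda>Y. {z. \<forall>y\<in>Y. mat_mult z y \<in> {0} \<and> mat_mult y z \<in> {0}}"
  note A = is_submodule_multipliers[OF is_submodule_zero]
  have "x C \<in> ?A (block D)" if D: "D \<in> support M // E" for D
  proof (cases "D = C")
    case True
    have "x F \<in> ?A (block C)" if "F \<in> K - {C}" for F
      using distinct_blocks_annihilate[of F C] x CQ K that by blast
    then show ?thesis
      unfolding xC True by (intro is_submoduleD(3)[OF A] is_submodule_sum[OF A])
  next
    case False
    then show ?thesis
      using distinct_blocks_annihilate[OF CQ D] x[OF C] by blast
  qed
  then have "(\<Union>D\<in>support M // E. block D) \<subseteq> ?A {x C}"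
    by blast
  then have "Mat I \<subseteq> ?A {x C}"
    unfolding span by (intro span_minimal A)
  then have "mat_mult (x C) y = 0" "mat_mult y (x C) = 0" if "y \<in> Mat I" for y
    using that by blast+
  then show "x C = 0"
    using faithful[of "x C"] x[OF C] block_subset_Mat by blast
qed (rule submodule_block, rule span)

lemma class_image:
  assumes C: "C \<in> support M // E"
    and shift: "degree_shift I M f \<gamma>" and E: "\<And>g. g \<in> support M \<Longrightarrow> (g, \<gamma> g) \<in> E"
  shows "\<gamma> ` C = C"
proof
  interpret degree_shift I M f \<gamma> by (rule shift)
  show "\<gamma> ` C \<subseteq> C"
    using E class_closed[OF C] class_subset[OF C] by blast
  show "C \<subseteq> \<gamma> ` C"
  proof
    fix g assume g: "g \<in> C"
    obtain h where h: "g = \<gamma> h"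
      using bij_\<gamma> by (metis bij_pointE)
    then have "(h, g) \<in> E"
      using g E class_subset[OF C] support_shift by blast
    then have "(g, h) \<in> E"
      using equiv_E by (meson equivE symD)
    then show "g \<in> \<gamma> ` C"
      using class_closed[OF C g] h by blast
  qed
qed

lemma block_invariant:
  assumes C: "C \<in> support M // E"
    and shift: "degree_shift I M f \<gamma>" and E: "\<And>g. g \<in> support M \<Longrightarrow> (g, \<gamma> g) \<in> E"
  shows "f ` block C = block C"
proof -
  interpret degree_shift I M f \<gamma> by (rule shift)
  have "f ` {mat_mult a b | a b. a \<in> M g \<and> b \<in> M (- g)} =
      {mat_mult a b | a b. a \<in> f ` M g \<and> b \<in> f ` M (- g)}" for g
  proof (intro equalityI subsetI)
    fix z assume "z \<in> f ` {mat_mult a b | a b. a \<in> M g \<and> b \<in> M (- g)}"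
    then obtain a b where "a \<in> M g" "b \<in> M (- g)" "z = f (mat_mult a b)" by blast
    then show "z \<in> {mat_mult a b | a b. a \<in> f ` M g \<and> b \<in> f ` M (- g)}"
      using f_mult M_subset_Mat by blast
  next
    fix z assume "z \<in> {mat_mult a b | a b. a \<in> f ` M g \<and> b \<in> f ` M (- g)}"
    then obtain a b where ab: "a \<in> M g" "b \<in> M (- g)" "z = mat_mult (f a) (f b)" by blast
    then have "z = f (mat_mult a b)"
      using f_mult M_subset_Mat by (metis subsetD)
    then show "z \<in> f ` {mat_mult a b | a b. a \<in> M g \<and> b \<in> M (- g)}"
      using ab by blast
  qed
  then have "f ` (M g \<union> {mat_mult a b | a b. a \<in> M g \<and> b \<in> M (- g)}) =
      M (\<gamma> g) \<union> {mat_mult a b | a b. a \<in> M (\<gamma> g) \<and> b \<in> M (- \<gamma> g)}" for g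
    by (simp add: image_Un image_component additive.minus[OF additive_\<gamma>])
  then have "f ` block_gens C = block_gens (\<gamma> ` C)"
    unfolding block_gens_def image_UN by simp
  moreover have "block_gens C \<subseteq> Mat I"
    using block_gens_homogeneous M_subset_Mat by blast
  ultimately show ?thesis
    using image_span[of "block_gens C"] class_image[OF C degree_shift_axioms E] unfolding block_def by simp
qed

lemma block_graded: "is_direct_sum (block C) UNIV (\<lambda>g. block C \<inter> M g)"
  unfolding block_def by (rule span_homogeneous_graded[OF block_gens_homogeneous])

end


section \<open>The connection relation\<close>

locale connection_setting =
  fixes \<alpha> \<beta> :: "'g::ab_group_add \<Rightarrow> 'g" and S :: "'g set"
  assumes additive_\<alpha>: "additive \<alpha>" and additive_\<beta>: "additive \<beta>"
    and comm: "\<alpha> (\<beta> x) = \<beta> (\<alpha> x)"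
    and bij_\<beta>: "bij \<beta>"
    and S_\<alpha>: "\<alpha> x \<in> S \<longleftrightarrow> x \<in> S" and S_\<beta>: "\<beta> x \<in> S \<longleftrightarrow> x \<in> S"
    and S_neg: "x \<in> S \<Longrightarrow> - x \<in> S"
begin

lemmas \<alpha>_simps = additive.add[OF additive_\<alpha>] additive.minus[OF additive_\<alpha>]
lemmas \<beta>_simps = additive.add[OF additive_\<beta>] additive.minus[OF additive_\<beta>]

lemma additive_funpow: "additive f \<Longrightarrow> additive (f ^^ n)"
  for f :: "'g \<Rightarrow> 'g"
  by (induction n) (simp_all add: additive_def)

lemma funpow_commute: "(\<And>x. f (h x) = h (f x)) \<Longrightarrow> f ((h ^^ m) x) = (h ^^ m) (f x)"
  for f h :: "'g \<Rightarrow> 'g"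
  by (induction m) simp_all

lemma \<alpha>_pow: "\<alpha> ((\<alpha> ^^ m) x) = (\<alpha> ^^ m) (\<alpha> x)" "\<beta> ((\<alpha> ^^ m) x) = (\<alpha> ^^ m) (\<beta> x)"
  and \<beta>_pow: "\<alpha> ((\<beta> ^^ m) x) = (\<beta> ^^ m) (\<alpha> x)" "\<beta> ((\<beta> ^^ m) x) = (\<beta> ^^ m) (\<beta> x)"
  by (rule funpow_commute; simp add: comm)+

lemma pow_S: "(\<alpha> ^^ m) x \<in> S \<longleftrightarrow> x \<in> S" "(\<beta> ^^ m) x \<in> S \<longleftrightarrow> x \<in> S"
  by (induction m) (simp_all add: S_\<alpha> S_\<beta>)

lemma orbitI: "(\<alpha> ^^ m) ((\<beta> ^^ n) x) \<in> orbit \<alpha> \<beta> x"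
  by (auto simp: orbit_def)

lemma orbit_self: "x \<in> orbit \<alpha> \<beta> x"
  using orbitI[of 0 0 x] by simp

lemma orbit_step: "y \<in> orbit \<alpha> \<beta> x \<Longrightarrow> \<alpha> y \<in> orbit \<alpha> \<beta> x"
  "y \<in> orbit \<alpha> \<beta> x \<Longrightarrow> \<beta> y \<in> orbit \<alpha> \<beta> x"
proof -
  assume "y \<in> orbit \<alpha> \<beta> x"
  then obtain m n where y: "y = (\<alpha> ^^ m) ((\<beta> ^^ n) x)"
    by (auto simp: orbit_def)
  show "\<alpha> y \<in> orbit \<alpha> \<beta> x"
    using orbitI[of "Suc m" n x] by (simp add: y)
  show "\<beta> y \<in> orbit \<alpha> \<beta> x"
    using orbitI[of m "Suc n" x] by (simp add: y \<alpha>_pow)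
qed

text \<open>An element of a signed orbit is the value of one of the operators plus or minus a monomial in
  the two automorphisms. Such an operator can be applied to other elements as well, which is how a
  connection is carried along.\<close>

lemma pm_orbit_operator:
  assumes "x \<in> pm_orbit \<alpha> \<beta> h"
  obtains \<gamma> where "x = \<gamma> h" "additive \<gamma>" "\<And>y. \<gamma> y \<in> pm_orbit \<alpha> \<beta> y"
    "\<And>y. \<gamma> (\<alpha> y) = \<alpha> (\<gamma> y)" "\<And>y. \<gamma> (\<beta> y) = \<beta> (\<gamma> y)"
proof -
  from assms obtain m n where
    "x = (\<alpha> ^^ m) ((\<beta> ^^ n) h) \<or> x = - (\<alpha> ^^ m) ((\<beta> ^^ n) h)"
    by (auto simp: pm_orbit_def orbit_def)
  moreover have "additive (\<lambda>y. (\<alpha> ^^ m) ((\<beta> ^^ n) y))"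
    using additive_funpow[OF additive_\<alpha>, of m] additive_funpow[OF additive_\<beta>, of n]
    by (simp add: additive_def)
  moreover from this have "additive (\<lambda>y. - (\<alpha> ^^ m) ((\<beta> ^^ n) y))"
    by (simp add: additive_def)
  moreover have "(\<alpha> ^^ m) ((\<beta> ^^ n) y) \<in> pm_orbit \<alpha> \<beta> y"
    "- (\<alpha> ^^ m) ((\<beta> ^^ n) y) \<in> pm_orbit \<alpha> \<beta> y" for y
    using orbitI[of m n y] by (simp_all add: pm_orbit_def)
  ultimately show thesis
    using that[of "\<lambda>y. (\<alpha> ^^ m) ((\<beta> ^^ n) y)"] that[of "\<lambda>y. - (\<alpha> ^^ m) ((\<beta> ^^ n) y)"]
    by (auto simp: \<alpha>_pow \<beta>_pow \<alpha>_simps \<beta>_simps)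
qed

lemma pm_orbit_step: "y \<in> pm_orbit \<alpha> \<beta> x \<Longrightarrow> \<alpha> y \<in> pm_orbit \<alpha> \<beta> x"
  "y \<in> pm_orbit \<alpha> \<beta> x \<Longrightarrow> \<beta> y \<in> pm_orbit \<alpha> \<beta> x"
  using orbit_step[of _ x] by (auto simp: pm_orbit_def \<alpha>_simps \<beta>_simps)

lemma orbit_subset_S: "x \<in> S \<Longrightarrow> orbit \<alpha> \<beta> x \<subseteq> S"
  by (auto simp: orbit_def pow_S)

lemma pm_orbit_subset_S: "x \<in> S \<Longrightarrow> pm_orbit \<alpha> \<beta> x \<subseteq> S"
  using orbit_subset_S S_neg by (auto simp: pm_orbit_def)

lemma pm_orbit_uminus: "pm_orbit \<alpha> \<beta> (- x) = pm_orbit \<alpha> \<beta> x"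
proof -
  have "orbit \<alpha> \<beta> (- x) = uminus ` orbit \<alpha> \<beta> x"
    by (auto simp: orbit_def image_iff additive.minus[OF additive_funpow[OF additive_\<alpha>]]
        additive.minus[OF additive_funpow[OF additive_\<beta>]])
  then show ?thesis
    by (auto simp: pm_orbit_def image_image)
qed

lemma conn_sum_1: "conn_sum \<alpha> \<beta> s (Suc 0) = s (Suc 0)"
  by (simp add: conn_sum_def)

lemma conn_sum_Suc:
  assumes "l \<ge> 1"
  shows "conn_sum \<alpha> \<beta> s (Suc l) = \<alpha> (conn_sum \<alpha> \<beta> s l) + \<beta> (s (Suc l))"
proof -
  have pow: "(\<alpha> ^^ (Suc n - t)) y = \<alpha> ((\<alpha> ^^ (n - t)) y)" if "t \<le> n" for n t y
    using that by (simp add: Suc_diff_le)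
  have "(\<Sum>t=2..Suc l. (\<alpha> ^^ (Suc l - t)) (\<beta> (s t))) =
      (\<Sum>t=2..l. \<alpha> ((\<alpha> ^^ (l - t)) (\<beta> (s t)))) + \<beta> (s (Suc l))"
    using assms pow by (simp add: sum.atLeast_Suc_atMost)
  then show ?thesis
    using assms pow[of 1 l "s 1"] 
    by (simp add: conn_sum_def \<alpha>_simps additive.sum[OF additive_\<alpha>] add.assoc)
qed

text \<open>The partial sums of a connection obey a recursion which mentions neither their number nor the
  sequence. The predicate below records the values that partial sums can take; existence of a
  connection becomes the existence of one such value.\<close>

inductive reach :: "'g \<Rightarrow> 'g \<Rightarrow> bool" for g where
  start: "x \<in> orbit \<alpha> \<beta> g \<Longrightarrow> reach g x"
| step: "reach g x \<Longrightarrow> u \<in> S \<Longrightarrow> \<alpha> x + \<beta> u \<in> S \<Longrightarrow> reach g (\<alpha> x + \<beta> u)"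

lemma connection_reach:
  assumes c: "connection \<alpha> \<beta> S g g' k s" and g': "g' \<in> S"
  shows "conn_sum \<alpha> \<beta> s k \<in> pm_orbit \<alpha> \<beta> g'" "reach g (conn_sum \<alpha> \<beta> s k)"
proof -
  show last: "conn_sum \<alpha> \<beta> s k \<in> pm_orbit \<alpha> \<beta> g'"
    using c by (auto simp: connection_def conn_sum_1 split: if_splits)
  have k: "k \<ge> 1" and first: "s 1 \<in> orbit \<alpha> \<beta> g" and sS: "\<And>l. l \<in> {1..k} \<Longrightarrow> s l \<in> S"
    using c by (auto simp: connection_def split: if_splits)
  have sumS: "conn_sum \<alpha> \<beta> s l \<in> S" if "2 \<le> l" "l \<le> k" for l
  proof (cases "l = k")
    case True
    then show ?thesis using last pm_orbit_subset_S[OF g'] by blast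
  next
    case False
    then show ?thesis using that c by (auto simp: connection_def split: if_splits)
  qed
  have "reach g (conn_sum \<alpha> \<beta> s l)" if "1 \<le> l" "l \<le> k" for l
    using that
  proof (induction l rule: dec_induct)
    case base
    then show ?case using first by (auto simp: conn_sum_1 intro: start)
  next
    case (step n)
    then show ?case
      using sS[of "Suc n"] sumS[of "Suc n"] reach.step[of g "conn_sum \<alpha> \<beta> s n" "s (Suc n)"]
      by (simp add: conn_sum_Suc)
  qed
  then show "reach g (conn_sum \<alpha> \<beta> s k)"
    using k by blast
qed

lemma reach_sequence:
  assumes "reach g x" "g \<in> S"
  shows "\<exists>k s. k \<ge> 1 \<and> (\<forall>l\<in>{1..k}. s l \<in> S) \<and> s 1 \<in> orbit \<alpha> \<beta> g \<and>
    (\<forall>l\<in>{1..k}. conn_sum \<alpha> \<beta> s l \<in> S) \<and> conn_sum \<alpha> \<beta> s k = x"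
  using assms(1)
proof induction
  case (start x)
  then show ?case
    using orbit_subset_S[OF assms(2)]
    by (intro exI[of _ 1] exI[of _ "\<lambda>_. x"]) (auto simp: conn_sum_1)
next
  case (step x u)
  then obtain k s where k: "k \<ge> 1" and s: "\<forall>l\<in>{1..k}. s l \<in> S" "s 1 \<in> orbit \<alpha> \<beta> g"
    "\<forall>l\<in>{1..k}. conn_sum \<alpha> \<beta> s l \<in> S" "conn_sum \<alpha> \<beta> s k = x" by blast
  let ?s = "s(Suc k := u)"
  have same: "conn_sum \<alpha> \<beta> ?s l = conn_sum \<alpha> \<beta> s l" if "l \<le> k" for l
    using that k unfolding conn_sum_def by (auto intro!: sum.cong)
  then have last: "conn_sum \<alpha> \<beta> ?s (Suc k) = \<alpha> x + \<beta> u"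
    using k s(4) by (simp add: conn_sum_Suc)
  show ?case
    using k s step.hyps same last
    by (intro exI[of _ "Suc k"] exI[of _ ?s]) (auto simp: le_Suc_eq simp del: fun_upd_apply, auto)
qed

lemma conn_rel_iff:
  "(g, g') \<in> conn_rel \<alpha> \<beta> S \<longleftrightarrow> g \<in> S \<and> g' \<in> S \<and> (\<exists>x\<in>pm_orbit \<alpha> \<beta> g'. reach g x)"
proof safe
  assume "(g, g') \<in> conn_rel \<alpha> \<beta> S"
  then show "g \<in> S" "g' \<in> S" "\<exists>x\<in>pm_orbit \<alpha> \<beta> g'. reach g x"
    using connection_reach by (auto simp: conn_rel_def) blast
next
  fix x assume *: "g \<in> S" "g' \<in> S" "x \<in> pm_orbit \<alpha> \<beta> g'" "reach g x"
  from reach_sequence[OF *(4,1)] obtain k s where "k \<ge> 1" "\<forall>l\<in>{1..k}. s l \<in> S"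
    "s 1 \<in> orbit \<alpha> \<beta> g" "\<forall>l\<in>{1..k}. conn_sum \<alpha> \<beta> s l \<in> S" "conn_sum \<alpha> \<beta> s k = x" by blast
  then have "connection \<alpha> \<beta> S g g' k s"
    using *(3) by (auto simp: connection_def conn_sum_1)
  then show "(g, g') \<in> conn_rel \<alpha> \<beta> S"
    using * by (auto simp: conn_rel_def)
qed

definition elementary_link :: "('g \<times> 'g) set" where
  "elementary_link = {(x, y). x \<in> S \<and> y \<in> S \<and>
     (y = \<alpha> x \<or> x = \<alpha> y \<or> y = \<beta> x \<or> x = \<beta> y \<or> y = - x \<or> (\<exists>u\<in>S. y = x + u))}"

lemma sym_elementary_link: "sym elementary_link"
proof (rule symI)
  fix x y assume "(x, y) \<in> elementary_link"
  moreover have "\<exists>v\<in>S. x = y + v" if "u \<in> S" "y = x + u" for u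
    using that S_neg by (intro bexI[of _ "- u"]) auto
  ultimately show "(y, x) \<in> elementary_link"
    by (auto simp: elementary_link_def)
qed

lemma link_\<alpha>: "x \<in> S \<Longrightarrow> (x, \<alpha> x) \<in> elementary_link"
  and link_\<beta>: "x \<in> S \<Longrightarrow> (x, \<beta> x) \<in> elementary_link"
  and link_neg: "x \<in> S \<Longrightarrow> (x, - x) \<in> elementary_link"
  and link_add: "x \<in> S \<Longrightarrow> u \<in> S \<Longrightarrow> x + u \<in> S \<Longrightarrow> (x, x + u) \<in> elementary_link"
  by (auto simp: elementary_link_def S_\<alpha> S_\<beta> S_neg)

lemma orbit_linked:
  assumes "g \<in> S" "x \<in> orbit \<alpha> \<beta> g"
  shows "(g, x) \<in> elementary_link\<^sup>*"
proof -
  have \<beta>: "(g, (\<beta> ^^ n) g) \<in> elementary_link\<^sup>*" for n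
  proof (induction n)
    case (Suc n)
    then show ?case
      using link_\<beta>[of "(\<beta> ^^ n) g"] assms(1) by (simp add: pow_S rtrancl_into_rtrancl)
  qed simp
  have "(g, (\<alpha> ^^ m) ((\<beta> ^^ n) g)) \<in> elementary_link\<^sup>*" for m n
  proof (induction m)
    case (Suc m)
    then show ?case
      using link_\<alpha>[of "(\<alpha> ^^ m) ((\<beta> ^^ n) g)"] assms(1)
      by (simp add: pow_S rtrancl_into_rtrancl)
  qed (simp add: \<beta>)
  then show ?thesis
    using assms(2) by (auto simp: orbit_def)
qed

lemma pm_orbit_linked:
  assumes "g \<in> S" "x \<in> pm_orbit \<alpha> \<beta> g"
  shows "(g, x) \<in> elementary_link\<^sup>*"
proof -
  consider "x \<in> orbit \<alpha> \<beta> g" | y where "y \<in> orbit \<alpha> \<beta> g" "x = - y"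
    using assms(2) by (auto simp: pm_orbit_def)
  then show ?thesis
  proof cases
    case 2
    then have "y \<in> S"
      using orbit_subset_S[OF assms(1)] by blast
    then show ?thesis
      using orbit_linked[OF assms(1) 2(1)] link_neg 2(2) by (auto intro: rtrancl_into_rtrancl)
  qed (rule orbit_linked[OF assms(1)])
qed

lemma reach_linked:
  assumes "reach g x" "g \<in> S"
  shows "x \<in> S \<and> (g, x) \<in> elementary_link\<^sup>*"
  using assms(1)
proof induction
  case (start x)
  then show ?case using orbit_linked[OF assms(2)] orbit_subset_S[OF assms(2)] by blast
next
  case (step x u)
  then have "(x, \<alpha> x) \<in> elementary_link" "(\<alpha> x, \<alpha> x + \<beta> u) \<in> elementary_link"
    by (auto intro!: link_\<alpha> link_add simp: S_\<alpha> S_\<beta>)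
  then show ?case
    using step by (meson rtrancl_into_rtrancl)
qed

lemma reach_step: "reach g x \<Longrightarrow> reach g (\<alpha> x)" "reach g x \<Longrightarrow> reach g (\<beta> x)"
proof -
  assume "reach g x"
  then have "reach g (\<alpha> x) \<and> reach g (\<beta> x)"
  proof induction
    case (start x)
    then show ?case using orbit_step by (auto intro: reach.start)
  next
    case (step x u)
    have "reach g (\<alpha> (\<alpha> x) + \<beta> (\<alpha> u))"
      using step S_\<alpha>[of "\<alpha> x + \<beta> u"] reach.step[of g "\<alpha> x" "\<alpha> u"]
      by (simp add: S_\<alpha> \<alpha>_simps comm)
    moreover have "reach g (\<alpha> (\<beta> x) + \<beta> (\<beta> u))"
      using step S_\<beta>[of "\<alpha> x + \<beta> u"] reach.step[of g "\<beta> x" "\<beta> u"]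
      by (simp add: S_\<beta> \<beta>_simps comm)
    ultimately show ?case
      by (simp add: \<alpha>_simps \<beta>_simps comm)
  qed
  then show "reach g (\<alpha> x)" "reach g (\<beta> x)" by auto
qed

text \<open>Conversely, a chain of elementary links is followed by a connection. Only images of the
  endpoints under signed monomials are met, so a link by addition of \<open>u\<close> is imitated by
  adding the image of \<open>u\<close> under the operator that is in force; one more factor \<open>\<alpha>\<close> is
  built in by the recursion of the partial sums, and one factor \<open>\<beta>\<close> has to be undone.\<close>

lemma linked_reach:
  assumes "(g, h) \<in> elementary_link\<^sup>*" "g \<in> S"
  shows "\<exists>x\<in>pm_orbit \<alpha> \<beta> h. reach g x"
  using assms(1)
proof induction
  case base
  then show ?case
    using orbit_self[of g] start[of g g] by (auto simp: pm_orbit_def)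
next
  case (step h y)
  then obtain x where x: "x \<in> pm_orbit \<alpha> \<beta> h" "reach g x" by blast
  obtain \<gamma> where \<gamma>: "x = \<gamma> h" "additive \<gamma>" "\<And>y. \<gamma> y \<in> pm_orbit \<alpha> \<beta> y"
    "\<And>y. \<gamma> (\<alpha> y) = \<alpha> (\<gamma> y)" "\<And>y. \<gamma> (\<beta> y) = \<beta> (\<gamma> y)"
    using pm_orbit_operator[OF x(1)] by blast
  have S: "h \<in> S" "y \<in> S"
    using step.hyps(2) by (auto simp: elementary_link_def)
  consider "y = \<alpha> h" | "h = \<alpha> y" | "y = \<beta> h" | "h = \<beta> y" | "y = - h"
    | u where "u \<in> S" "y = h + u"
    using step.hyps(2) by (auto simp: elementary_link_def)
  then show ?case
  proof cases
    case 1
    then show ?thesis using \<gamma> reach_step(1)[OF x(2)] by metis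
  next
    case 2
    then show ?thesis using \<gamma> x pm_orbit_step(1) by metis
  next
    case 3
    then show ?thesis using \<gamma> reach_step(2)[OF x(2)] by metis
  next
    case 4
    then show ?thesis using \<gamma> x pm_orbit_step(2) by metis
  next
    case 5
    then show ?thesis using x by (metis pm_orbit_uminus)
  next
    case (6 u)
    obtain w where w: "\<beta> w = \<alpha> (\<gamma> u)"
      using bij_\<beta> by (metis bij_pointE)
    have "\<gamma> u \<in> S"
      using \<gamma>(3) pm_orbit_subset_S[OF 6(1)] by blast
    then have "w \<in> S"
      using w S_\<alpha> S_\<beta> by metis
    moreover have sum: "\<alpha> x + \<beta> w = \<alpha> (\<gamma> y)"
      by (simp add: \<gamma>(1) w 6(2) additive.add[OF \<gamma>(2)] \<alpha>_simps)
    moreover have "\<alpha> (\<gamma> y) \<in> pm_orbit \<alpha> \<beta> y"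
      using \<gamma>(3) pm_orbit_step by blast
    ultimately show ?thesis
      using reach.step[OF x(2), of w] pm_orbit_subset_S[OF S(2)] by (metis subsetD)
  qed
qed

text \<open>This makes symmetry and transitivity of the connection relation evident, whereas joining and
  reversing connections by hand would mean rewriting all their members.\<close>

theorem conn_rel_eq: "conn_rel \<alpha> \<beta> S = elementary_link\<^sup>* \<inter> S \<times> S"
proof -
  have "(g, g') \<in> conn_rel \<alpha> \<beta> S \<longleftrightarrow> (g, g') \<in> elementary_link\<^sup>*" if "g \<in> S" "g' \<in> S" for g g'
  proof
    assume "(g, g') \<in> conn_rel \<alpha> \<beta> S"
    then obtain x where x: "x \<in> pm_orbit \<alpha> \<beta> g'" "reach g x"
      by (auto simp: conn_rel_iff)
    have "(x, g') \<in> elementary_link\<^sup>*"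
      using pm_orbit_linked[OF that(2) x(1)] sym_rtrancl[OF sym_elementary_link] by (meson symD)
    then show "(g, g') \<in> elementary_link\<^sup>*"
      using reach_linked[OF x(2) that(1)] by auto
  next
    assume "(g, g') \<in> elementary_link\<^sup>*"
    then show "(g, g') \<in> conn_rel \<alpha> \<beta> S"
      using linked_reach that by (auto simp: conn_rel_iff)
  qed
  moreover have "conn_rel \<alpha> \<beta> S \<subseteq> S \<times> S"
    by (auto simp: conn_rel_def)
  ultimately show ?thesis
    by blast
qed

lemma equiv_conn_rel: "equiv S (conn_rel \<alpha> \<beta> S)"
  unfolding conn_rel_eq
proof (rule equivI)
  show "sym (elementary_link\<^sup>* \<inter> S \<times> S)"
    using sym_rtrancl[OF sym_elementary_link] by (auto simp: sym_def)
  show "trans (elementary_link\<^sup>* \<inter> S \<times> S)"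
    by (auto simp: trans_def)
qed (auto simp: refl_on_def)

lemma conn_rel_links:
  "x \<in> S \<Longrightarrow> (x, \<alpha> x) \<in> conn_rel \<alpha> \<beta> S"
  "x \<in> S \<Longrightarrow> (x, \<beta> x) \<in> conn_rel \<alpha> \<beta> S"
  "x \<in> S \<Longrightarrow> (x, - x) \<in> conn_rel \<alpha> \<beta> S"
  "x \<in> S \<Longrightarrow> u \<in> S \<Longrightarrow> x + u \<in> S \<Longrightarrow> (x, x + u) \<in> conn_rel \<alpha> \<beta> S"
  unfolding conn_rel_eq
  using link_\<alpha> link_\<beta> link_neg link_add by (auto simp: S_\<alpha> S_\<beta> S_neg)

end


section \<open>The decomposition\<close>

text \<open>Both the zero part of a class and the condition on the component of degree zero are written
  with the twisted product and twisted degrees. Undoing the twists turns them into the untwisted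
  products of opposite components.\<close>

lemma star_products:
  assumes "degree_shift I M \<psi> \<alpha>" "degree_shift I M \<phi> \<beta>"
  shows "{star \<psi> \<phi> x y | x y. x \<in> M g \<and> y \<in> M h} =
    {mat_mult a b | a b. a \<in> M (\<alpha> g) \<and> b \<in> M (\<beta> h)}"
  unfolding degree_shift.image_component[OF assms(1), symmetric]
    degree_shift.image_component[OF assms(2), symmetric] star_def by blast

theorem corollary4p6:
  fixes I :: "'i set"
    and \<psi> \<phi> :: "('i, 'r::comm_ring) fmat \<Rightarrow> ('i, 'r) fmat"
    and \<alpha> \<beta> :: "'g::ab_group_add \<Rightarrow> 'g"
    and M :: "'g \<Rightarrow> ('i, 'r) fmat set"
  assumes "mat_automorphism I \<psi>" and "mat_automorphism I \<phi>"
    and "\<forall>A\<in>Mat I. \<psi> (\<phi> A) = \<phi> (\<psi> A)"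
    and "group_automorphism \<alpha>" and "group_automorphism \<beta>"
    and "\<alpha> \<circ> \<beta> = \<beta> \<circ> \<alpha>"
    and "is_direct_sum (Mat I) UNIV M"
    and "\<forall>g. \<psi> ` M g \<subseteq> M (\<alpha> g)"
    and "\<forall>g. \<phi> ` M g \<subseteq> M (\<beta> g)"
    and "\<forall>g g'. star_set \<psi> \<phi> (M g) (M g') \<subseteq> M (\<alpha> g + \<beta> g')"
    and "\<forall>g\<in>support M. - g \<in> support M"
    and "centre I \<psi> \<phi> = {0}"
    and "M 0 = sum_submodules (support M) (\<lambda>g. star_set \<psi> \<phi> (M g) (M (- inv \<beta> (\<alpha> g))))"
  shows "(\<forall>C \<in> support M // conn_rel \<alpha> \<beta> (support M).
            graded_ideal I \<psi> \<phi> M (class_ideal \<psi> \<phi> \<alpha> \<beta> M C)) \<and>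
         is_direct_sum (Mat I) (support M // conn_rel \<alpha> \<beta> (support M))
           (class_ideal \<psi> \<phi> \<alpha> \<beta> M)"
proof -
  let ?E = "conn_rel \<alpha> \<beta> (support M)"
  let ?Q = "support M // ?E"
  have graded: "graded_mat I M"
    using assms(7) by unfold_locales
  interpret \<psi>: degree_shift I M \<psi> \<alpha>
    using assms(1,4,7,8) by unfold_locales auto
  interpret \<phi>: degree_shift I M \<phi> \<beta>
    using assms(2,5,7,9) by unfold_locales auto
  note products = star_products[OF \<psi>.degree_shift_axioms \<phi>.degree_shift_axioms]
  have comm: "\<alpha> (\<beta> x) = \<beta> (\<alpha> x)" for x
    using assms(6) by (metis comp_apply)
  interpret connection_setting \<alpha> \<beta> "support M"
    using \<psi>.additive_\<gamma> \<phi>.additive_\<gamma> comm \<phi>.bij_\<gamma> \<psi>.support_shift \<phi>.support_shift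
      assms(11)[rule_format] by (rule connection_setting.intro)
  have mult: "mat_mult x y \<in> M (g + h)" if "x \<in> M g" "y \<in> M h" for x y g h
  proof -
    obtain g' h' where gh: "g = \<alpha> g'" "h = \<beta> h'"
      using \<psi>.bij_\<gamma> \<phi>.bij_\<gamma> by (metis bij_pointE)
    then have "mat_mult x y \<in> {star \<psi> \<phi> x y | x y. x \<in> M g' \<and> y \<in> M h'}"
      unfolding products using that by blast
    then have "mat_mult x y \<in> star_set \<psi> \<phi> (M g') (M h')"
      unfolding star_set_def by (rule subsetD[OF span_superset])
    then show ?thesis
      using assms(10) gh by blast
  qed
  interpret graded_blocks I M ?E
    by (intro graded_blocks.intro graded_blocks_axioms.intro graded mult equiv_conn_rel conn_rel_links)
  let ?P = "\<lambda>g. {mat_mult a b | a b. a \<in> M g \<and> b \<in> M (- g)}"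
  have "M 0 = mat_span (\<Union>g\<in>support M. ?P (\<alpha> g))"
    using assms(13) \<phi>.bij_\<gamma>
    unfolding sum_submodules_def star_set_def span_UN_span products
    by (simp add: \<beta>_simps bij_is_surj surj_f_inv_f)
  moreover have "(\<Union>g\<in>support M. ?P (\<alpha> g)) \<subseteq> (\<Union>g\<in>support M. ?P g)"
    using S_\<alpha> by blast
  ultimately have "M 0 \<subseteq> mat_span (\<Union>g\<in>support M. ?P g)"
    by (simp only: span_mono)
  then have span: "Mat I = mat_span (\<Union>C\<in>?Q. block C)"
    by (rule blocks_span)
  have faithful: "v = 0" if v: "v \<in> Mat I" and left: "\<And>y. y \<in> Mat I \<Longrightarrow> mat_mult v y = 0"
    and right: "\<And>y. y \<in> Mat I \<Longrightarrow> mat_mult y v = 0"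
    for v :: "('i, 'r) fmat"
  proof -
    \<comment> \<open>Each automorphism is onto, so the factor it twists can be rewritten as a value of the
      other one, which is then taken out of the product.\<close>
    have "star \<psi> \<phi> v y = 0" "star \<psi> \<phi> y v = 0" if y: "y \<in> Mat I" for y
    proof -
      obtain z where z: "z \<in> Mat I" "\<psi> z = \<phi> y"
        using \<phi>.f_mem[OF y] \<psi>.f_bij by (metis bij_betw_iff_bijections)
      show "star \<psi> \<phi> v y = 0"
        using \<psi>.f_mult[OF v z(1)] left[OF z(1)] \<psi>.f_zero z(2) by (simp add: star_def)
      obtain w where w: "w \<in> Mat I" "\<phi> w = \<psi> y"
        using \<psi>.f_mem[OF y] \<phi>.f_bij by (metis bij_betw_iff_bijections)
      show "star \<psi> \<phi> y v = 0"
        using \<phi>.f_mult[OF w(1) v] right[OF w(1)] \<phi>.f_zero w(2) by (simp add: star_def)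
    qed
    then have "star_set \<psi> \<phi> {v} (Mat I) \<subseteq> {0}" "star_set \<psi> \<phi> (Mat I) {v} \<subseteq> {0}"
      unfolding star_set_def by (intro span_minimal is_submodule_zero; auto)+
    then have "star_set \<psi> \<phi> {v} (Mat I) = {0}" "star_set \<psi> \<phi> (Mat I) {v} = {0}"
      using is_submoduleD(1)[OF is_submodule_span] unfolding star_set_def by blast+
    then have "v \<in> centre I \<psi> \<phi>"
      using v by (simp add: centre_def set_plus_def)
    then show ?thesis
      using assms(12) by simp
  qed
  have inv: "\<psi> ` block C = block C" "\<phi> ` block C = block C" if "C \<in> ?Q" for C
    using block_invariant[OF that \<psi>.degree_shift_axioms] block_invariant[OF that \<phi>.degree_shift_axioms]
      conn_rel_links by blast+
  have ideal_eq: "class_ideal \<psi> \<phi> \<alpha> \<beta> M C = block C" if C: "C \<in> ?Q" for C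
  proof -
    have "\<alpha> ` \<beta> ` C = C"
      using class_image[OF C \<psi>.degree_shift_axioms] class_image[OF C \<phi>.degree_shift_axioms]
        conn_rel_links by simp
    then have "(\<Union>g\<in>C. ?P g) = (\<Union>g\<in>\<alpha> ` \<beta> ` C. ?P g)"
      by simp
    also have "\<dots> = (\<Union>g\<in>C. ?P (\<alpha> (\<beta> g)))"
      by (simp only: image_image)
    finally have "class_zero_part \<psi> \<phi> \<alpha> \<beta> M C = mat_span (\<Union>g\<in>C. ?P g)"
      unfolding class_zero_part_def star_set_def span_UN_span products
      by (simp add: \<beta>_simps comm)
    then show ?thesis
      unfolding class_ideal_def sum_submodules_def block_def block_gens_def
      by (simp add: span_plus_span UN_Un_distrib Un_commute)
  qed
  have "graded_ideal I \<psi> \<phi> M (block C)" if C: "C \<in> ?Q" for C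
  proof -
    have "star \<psi> \<phi> x y \<in> block C" "star \<psi> \<phi> y x \<in> block C" if "x \<in> block C" "y \<in> Mat I" for x y
      using that inv[OF C] block_ideal[OF C, of "\<psi> x" "\<phi> y"] block_ideal[OF C, of "\<phi> x" "\<psi> y"]
        \<psi>.f_mem \<phi>.f_mem by (auto simp: star_def)
    then have "star_set \<psi> \<phi> (block C) (Mat I) \<subseteq> block C" "star_set \<psi> \<phi> (Mat I) (block C) \<subseteq> block C"
      unfolding star_set_def by (intro span_minimal submodule_block; auto)+
    then have "star_set \<psi> \<phi> (block C) (Mat I) + star_set \<psi> \<phi> (Mat I) (block C)
        \<subseteq> block C + block C"
      by (rule set_plus_mono2)
    also have "\<dots> \<subseteq> block C"
      unfolding block_def span_plus_span by simp
    finally show ?thesis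
      using inv[OF C] block_subset_Mat submodule_block block_graded
      by (simp add: graded_ideal_def)
  qed
  moreover have "is_direct_sum (Mat I) ?Q block"
    using span faithful by (rule blocks_direct)
  then have "is_direct_sum (Mat I) ?Q (class_ideal \<psi> \<phi> \<alpha> \<beta> M)"
    using is_direct_sum_cong[of ?Q "class_ideal \<psi> \<phi> \<alpha> \<beta> M" block, OF ideal_eq] by simp
  ultimately show ?thesis
    using ideal_eq by simp
qed

end
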